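(* For $n\ge 8$ and $t>0$, there is no even Schwartz function $h:\mathbb{R}^n\to\mathbb{R}$ satisfying all of the following: (i) $h(x)\ge e^{-t\|x\|^2}$ for every nonzero $x$ in every unimodular integral lattice $\Lambda\subset\mathbb{R}^n$; (ii) $\widehat h(x)\le 0$ for every nonzero $x$ in every unimodular integral lattice $\Lambda\subset\mathbb{R}^n$; (iii) $1+\widehat h(0)-h(0)=\Theta_{\mathbb{Z}^n}(t)$.
   Context: A lattice $\Lambda\subset\mathbb{R}^n$ means a full-rank lattice. It is integral if $\langle x,y\rangle\in\mathbb{Z}$ for all $x,y\in\Lambda$, and unimodular if $\operatorname{covol}(\Lambda)=1$. The Gaussian mass of $\Lambda$ is $\Theta_\Lambda(t)=\sum_{x\in\Lambda}e^{-t\|x\|^2}$ for $t>0$. The Fourier transform is $\widehat f(\xi)=\int_{\mathbb{R}^n}f(x)e^{-2\pi i\langle x,\xi\rangle}\,dx$; for $h$ real and even, $\widehat h$ is real-valued. *)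

theory Defs
  imports "HOL-Analysis.Analysis"
begin

section \<open>Lattices in \<open>\<real>\<^sup>n\<close>\<close>

definition int_vectors :: "(real ^ 'n) set" where
  "int_vectors = {x. \<forall>i. x $ i \<in> \<int>}"

text \<open>The columns of an invertible matrix are a basis of the whole space.\<close>
definition lattice_of :: "real ^ 'n ^ 'n \<Rightarrow> (real ^ 'n) set" where
  "lattice_of A = (*v) A ` int_vectors"

definition is_lattice :: "(real ^ 'n) set \<Rightarrow> bool" where
  "is_lattice L \<longleftrightarrow> (\<exists>A. invertible A \<and> L = lattice_of A)"

text \<open>Meaningful for lattices only; independence of the chosen basis is
  \<open>covol_lattice_of\<close> below.\<close>
definition covol :: "(real ^ 'n) set \<Rightarrow> real" where
  "covol L = (THE c. \<exists>A. invertible A \<and> L = lattice_of A \<and> c = \<bar>det A\<bar>)"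

definition integral_lattice :: "(real ^ 'n) set \<Rightarrow> bool" where
  "integral_lattice L \<longleftrightarrow> is_lattice L \<and> (\<forall>x\<in>L. \<forall>y\<in>L. x \<bullet> y \<in> \<int>)"

definition unimodular_lattice :: "(real ^ 'n) set \<Rightarrow> bool" where
  "unimodular_lattice L \<longleftrightarrow> is_lattice L \<and> covol L = 1"

definition gaussian_mass :: "(real ^ 'n) set \<Rightarrow> real \<Rightarrow> real" where
  "gaussian_mass L t = (\<Sum>\<^sub>\<infinity>x\<in>L. exp (- t * (norm x)\<^sup>2))"

lemma matrix_inv_mult_left:
  fixes A :: "real ^ 'n ^ 'n"
  assumes "invertible A"
  shows "matrix_inv A ** A = mat 1"
  using someI_ex[OF assms[unfolded invertible_def]] unfolding matrix_inv_def by blast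

lemma int_entries_det:
  fixes M :: "real ^ 'n ^ 'n"
  assumes "\<And>z. z \<in> int_vectors \<Longrightarrow> M *v z \<in> int_vectors"
  shows "det M \<in> \<int>"
proof -
  have "M $ i $ j \<in> \<int>" for i j
  proof -
    have "axis j 1 \<in> (int_vectors :: (real ^ 'n) set)"
      by (simp add: int_vectors_def axis_def)
    then have "M *v axis j 1 \<in> int_vectors"
      by (rule assms)
    then show ?thesis
      by (simp add: int_vectors_def matrix_vector_mult_basis column_def)
  qed
  then show ?thesis
    unfolding det_def by (intro Ints_sum Ints_mult Ints_prod) auto
qed

lemma abs_det_lattice_of_eq:
  fixes A B :: "real ^ 'n ^ 'n"
  assumes A: "invertible A" and B: "invertible B" and eq: "lattice_of A = lattice_of B"
  shows "\<bar>det A\<bar> = \<bar>det B\<bar>"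
proof -
  have transition: "det (matrix_inv C ** D) \<in> \<int>"
    if C: "invertible C" and CD: "lattice_of C = lattice_of D" for C D :: "real ^ 'n ^ 'n"
  proof (rule int_entries_det)
    fix z :: "real ^ 'n" assume "z \<in> int_vectors"
    then have "D *v z \<in> lattice_of C"
      using CD by (simp add: lattice_of_def)
    then obtain w where w: "w \<in> int_vectors" "D *v z = C *v w"
      by (auto simp: lattice_of_def)
    have "(matrix_inv C ** D) *v z = (matrix_inv C ** C) *v w"
      by (simp add: w(2) flip: matrix_vector_mul_assoc)
    then show "(matrix_inv C ** D) *v z \<in> int_vectors"
      using w(1) C by (simp add: matrix_inv_mult_left)
  qed
  have det_inv: "det (matrix_inv C) * det C = 1" if "invertible C" for C :: "real ^ 'n ^ 'n"
    using that by (metis det_I det_mul matrix_inv_mult_left)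
  define d where "d = det (matrix_inv A ** B)"
  define e where "e = det (matrix_inv B ** A)"
  have "d \<in> \<int>" "e \<in> \<int>"
    using transition[OF A eq] transition[OF B eq[symmetric]] by (simp_all add: d_def e_def)
  moreover have "d * e = (det (matrix_inv A) * det A) * (det (matrix_inv B) * det B)"
    by (simp add: d_def e_def det_mul)
  then have de: "d * e = 1"
    by (simp add: det_inv A B)
  ultimately have "\<bar>d\<bar> = 1"
  proof -
    obtain m k :: int where "d = of_int m" "e = of_int k"
      using \<open>d \<in> \<int>\<close> \<open>e \<in> \<int>\<close> by (auto elim!: Ints_cases)
    with de have "m * k = 1"
      by (metis of_int_eq_1_iff of_int_mult)
    then have "\<bar>m\<bar> = 1"
      by (auto simp: zmult_eq_1_iff)
    then show ?thesis
      using \<open>d = of_int m\<close> by (metis of_int_1 of_int_abs)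
  qed
  moreover have "det B = (det (matrix_inv A) * det A) * det B"
    by (simp add: det_inv A)
  then have "det B = det A * d"
    by (simp only: d_def det_mul mult_ac)
  ultimately show ?thesis
    by (simp add: abs_mult)
qed

lemma covol_lattice_of:
  assumes "invertible A"
  shows "covol (lattice_of A) = \<bar>det A\<bar>"
  unfolding covol_def
  by (rule the_equality) (use assms in \<open>auto dest: abs_det_lattice_of_eq\<close>)

lemma lattice_of_mat_1: "lattice_of (mat 1) = int_vectors"
  by (simp add: lattice_of_def)

lemma int_vectors_unimodular_integral:
  "unimodular_lattice (int_vectors :: (real ^ 'n) set)"
  "integral_lattice (int_vectors :: (real ^ 'n) set)"
proof -
  have inv: "invertible (mat 1 :: real ^ 'n ^ 'n)"
    by (simp add: invertible_det_nz)
  then have L: "is_lattice (int_vectors :: (real ^ 'n) set)"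
    unfolding is_lattice_def by (metis lattice_of_mat_1)
  show "unimodular_lattice (int_vectors :: (real ^ 'n) set)"
    using L covol_lattice_of[OF inv] by (simp add: unimodular_lattice_def lattice_of_mat_1)
  show "integral_lattice (int_vectors :: (real ^ 'n) set)"
    using L by (auto simp: integral_lattice_def int_vectors_def inner_vec_def
        intro!: Ints_sum Ints_mult)
qed


section \<open>Schwartz functions\<close>

definition partial_deriv :: "'n \<Rightarrow> (real ^ 'n \<Rightarrow> real) \<Rightarrow> real ^ 'n \<Rightarrow> real" where
  "partial_deriv i f x = frechet_derivative f (at x) (axis i 1)"

primrec iter_partial_deriv :: "'n list \<Rightarrow> (real ^ 'n \<Rightarrow> real) \<Rightarrow> real ^ 'n \<Rightarrow> real" where
  "iter_partial_deriv [] f = f"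
| "iter_partial_deriv (i # is) f = partial_deriv i (iter_partial_deriv is f)"

text \<open>The differentiability clause, for all iterated partial derivatives, says that \<open>f\<close>
  is \<open>C\<^sup>\<infinity>\<close>; it also ensures that \<open>frechet_derivative\<close> never takes an unspecified value.\<close>
definition schwartz :: "(real ^ 'n \<Rightarrow> real) \<Rightarrow> bool" where
  "schwartz f \<longleftrightarrow>
    (\<forall>is. (\<forall>x. iter_partial_deriv is f differentiable (at x)) \<and>
          (\<forall>k::nat. bounded (range (\<lambda>x. norm x ^ k * iter_partial_deriv is f x))))"


section \<open>Fourier transform\<close>

definition fourier :: "(real ^ 'n \<Rightarrow> complex) \<Rightarrow> real ^ 'n \<Rightarrow> complex" where
  "fourier f \<xi> = (LINT x|lborel. f x * exp (- 2 * of_real pi * \<i> * of_real (x \<bullet> \<xi>)))"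

lemma fourier_even_real:
  fixes h :: "real ^ 'n \<Rightarrow> real"
  assumes schwartz: "schwartz h" and even: "\<And>x. h (- x) = h x"
  shows "fourier (\<lambda>x. of_real (h x)) \<xi> \<in> \<real>"
proof -
  have "h differentiable (at x)" for x
    using schwartz unfolding schwartz_def by (metis iter_partial_deriv.simps(1))
  then have "continuous_on UNIV h"
    by (meson continuous_at_imp_continuous_on differentiable_imp_continuous_within)
  then have [measurable]: "h \<in> borel_measurable borel"
    by (rule borel_measurable_continuous_onI)
  have distr: "distr lborel borel uminus = (lborel :: (real ^ 'n) measure)"
    using lborel_affine[of "-1" "0 :: real ^ 'n"] by (simp add: density_1)
  let ?g = "\<lambda>x. of_real (h x) * exp (- 2 * of_real pi * \<i> * of_real (x \<bullet> \<xi>)) :: complex"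
  have "cnj (fourier (\<lambda>x. of_real (h x)) \<xi>) = (LINT x|lborel. cnj (?g x))"
    unfolding fourier_def by (rule Bochner_Integration.integral_cnj [symmetric])
  also have "\<dots> = (LINT x|lborel. ?g (- x))"
    by (simp add: exp_cnj even)
  also have "\<dots> = (LINT x|distr lborel borel uminus. ?g x)"
    by (rule integral_distr [symmetric]) measurable
  also have "\<dots> = fourier (\<lambda>x. of_real (h x)) \<xi>"
    by (simp add: fourier_def distr)
  finally show ?thesis
    by (simp add: Reals_cnj_iff)
qed

text \<open>For a real, even Schwartz function the transform is real by
  \<open>fourier_even_real\<close>, so taking the real
  part only changes the type.\<close>
definition real_fourier :: "(real ^ 'n \<Rightarrow> real) \<Rightarrow> real ^ 'n \<Rightarrow> real" where
  "real_fourier h \<xi> = Re (fourier (\<lambda>x. of_real (h x)) \<xi>)"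

end

theory Submission
  imports Defs "HOL-Probability.Sinc_Integral" "HOL-Real_Asymp.Real_Asymp"
begin

text \<open>Apply Poisson summation to \<open>h \<circ> R\<close> on \<open>\<int>\<^sup>n\<close> for every orthogonal \<open>R\<close>: conditions (i)--(iii)
  leave no slack, so \<open>h\<close> agrees with the Gaussian and its transform vanishes at all nonzero points
  of all rotated copies of \<open>\<int>\<^sup>n\<close>. If \<open>s\<close> has entries \<open>1/2\<close> on four or eight coordinates and 0
  elsewhere, every point of \<open>\<int>\<^sup>n + s\<close> lies in such a copy. Poisson summation for the translate
  \<open>\<int>\<^sup>n + s\<close> therefore says that the Gaussian sum over it equals \<open>real_fourier h 0\<close>, that is, with
  \<open>a\<close> and \<open>b\<close> the theta sums over \<open>\<int> + 1/2\<close> and \<open>\<int>\<close>,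
  \<open>a ^ 4 * b ^ (n - 4) = a ^ 8 * b ^ (n - 8)\<close>. Hence \<open>a = b\<close>, which the duplication formulas for
  theta functions refute.\<close>

section \<open>Invariance and product formulas for Lebesgue measure\<close>

text \<open>Why no slack remains: for \<open>g = h \<circ> R\<close>, (i) and (iii) bound the sum of
  \<open>g\<close> over the integer vectors from below by \<open>real_fourier h 0\<close>, while
  Poisson summation and (ii) bound it from above by the same number. The obstacle is convergence on
  the dual side. Only continuity and decay of \<open>h\<close> are used, so the series of Fourier
  coefficients is never summed, only averaged by the Fejer kernel. The averages suffice because all
  nonzero frequencies carry coefficients of one sign: if their average tends to 0 at the shift 0, it
  does so at every shift. Why blocks of four: a vector with four entries 1/2 or -1/2 is a unit
  vector \<open>r\<close>, and the reflection in it moves such coordinates by half-integers as soon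
  as \<open>2 * (r \<bullet> x)\<close> is odd. Why two shifts: (iii) fixes only
  \<open>real_fourier h 0 - h 0\<close>, so a single shift leaves an unknown value, which the
  comparison of two eliminates. Two disjoint blocks of four are where dimension 8 enters.\<close>

lemma nn_integral_lborel_translation:
  fixes f :: "'a::euclidean_space \<Rightarrow> ennreal"
  assumes [measurable]: "f \<in> borel_measurable borel"
  shows "(\<integral>\<^sup>+x. f (x + a) \<partial>lborel) = (\<integral>\<^sup>+x. f x \<partial>lborel)"
proof -
  have "(\<integral>\<^sup>+x. f x \<partial>lborel) = (\<integral>\<^sup>+x. f x \<partial>distr lborel borel (\<lambda>x. a + x))"
    by (subst lborel_affine[of 1 a]) (simp_all add: density_1)
  then show ?thesis
    by (simp add: nn_integral_distr add.commute)
qed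

lemma nn_integral_lborel_reflect:
  fixes f :: "'a::euclidean_space \<Rightarrow> ennreal"
  assumes [measurable]: "f \<in> borel_measurable borel"
  shows "(\<integral>\<^sup>+x. f (a - x) \<partial>lborel) = (\<integral>\<^sup>+x. f x \<partial>lborel)"
proof -
  have "(\<integral>\<^sup>+x. f x \<partial>lborel) = (\<integral>\<^sup>+x. f x \<partial>distr lborel borel (\<lambda>x. a + (- 1) *\<^sub>R x))"
    by (subst lborel_affine[of "-1" a]) (simp_all add: density_1)
  then show ?thesis
    by (simp add: nn_integral_distr)
qed

text \<open>The usual uniqueness argument for Haar measure, comparing with a ball, which \<open>R\<close>
  preserves.\<close>
lemma distr_lborel_orthogonal:
  fixes R :: "'a::euclidean_space \<Rightarrow> 'a"
  assumes R: "orthogonal_transformation R"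
  shows "distr lborel borel R = lborel"
proof -
  have lin: "linear R"
    using R by (rule orthogonal_transformation_linear)
  have [measurable]: "R \<in> borel_measurable borel"
    using lin by (intro borel_measurable_continuous_onI linear_continuous_on linear_conv_bounded_linear[THEN iffD1])
  have R_norm: "norm (R x) = norm x" for x
    using R by (simp add: orthogonal_transformation_norm)
  have R_inv: "R (inv R y) = y" for y
    using orthogonal_transformation_surj[OF R] by (simp add: surj_f_inv_f)
  define g :: "'a \<Rightarrow> ennreal" where "g = indicator (ball 0 1)"
  have [measurable]: "g \<in> borel_measurable borel"
    unfolding g_def by (intro borel_measurable_indicator) auto
  have g_R: "g (R x) = g x" for x
    by (simp add: g_def indicator_def R_norm)
  have g_int: "(\<integral>\<^sup>+x. g x \<partial>lborel) = emeasure lborel (ball 0 1 :: 'a set)"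
    by (simp add: g_def)
  have g_pos: "(\<integral>\<^sup>+x. g x \<partial>lborel) \<noteq> 0"
    using open_not_negligible[of "ball 0 1 :: 'a set"] unfolding g_int
    by (auto simp: negligible_iff_null_sets null_sets_def)
  have g_fin: "(\<integral>\<^sup>+x. g x \<partial>lborel) \<noteq> \<infinity>"
    unfolding g_int using emeasure_lborel_ball_finite[of 0 1] by (simp add: less_top)
  have main: "(\<integral>\<^sup>+x. f (R x) \<partial>lborel) = (\<integral>\<^sup>+x. f x \<partial>lborel)"
    if [measurable]: "f \<in> borel_measurable borel" for f :: "'a \<Rightarrow> ennreal"
  proof -
    have "(\<integral>\<^sup>+x. f (R x) \<partial>lborel) * (\<integral>\<^sup>+x. g x \<partial>lborel)
        = (\<integral>\<^sup>+x. f (R x) * (\<integral>\<^sup>+y. g (y + R x) \<partial>lborel) \<partial>lborel)"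
      by (simp add: nn_integral_lborel_translation nn_integral_multc)
    also have "\<dots> = (\<integral>\<^sup>+x. \<integral>\<^sup>+y. f (R x) * g (y + R x) \<partial>lborel \<partial>lborel)"
      by (simp add: nn_integral_cmult)
    also have "\<dots> = (\<integral>\<^sup>+y. \<integral>\<^sup>+x. f (R x) * g (y + R x) \<partial>lborel \<partial>lborel)"
      by (rule lborel_pair.Fubini') measurable
    \<comment> \<open>Shifting \<open>x\<close> by \<open>inv R (- y)\<close> removes
      \<open>y\<close> from the argument of \<open>g\<close>, where invariance of the ball then
      removes \<open>R\<close>. The remaining \<open>R\<close> sits in \<open>f (R x - y)\<close>,
      and integrating over \<open>y\<close> first makes it disappear.\<close>
    also have "\<dots> = (\<integral>\<^sup>+y. \<integral>\<^sup>+x. f (R (x + inv R (- y))) * g (y + R (x + inv R (- y))) \<partial>lborel \<partial>lborel)"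
      by (intro nn_integral_cong nn_integral_lborel_translation[symmetric]) measurable
    also have "\<dots> = (\<integral>\<^sup>+y. \<integral>\<^sup>+x. f (R x - y) * g x \<partial>lborel \<partial>lborel)"
      by (simp add: linear_add[OF lin] R_inv g_R)
    also have "\<dots> = (\<integral>\<^sup>+x. \<integral>\<^sup>+y. f (R x - y) * g x \<partial>lborel \<partial>lborel)"
      by (rule lborel_pair.Fubini') measurable
    also have "\<dots> = (\<integral>\<^sup>+x. f x \<partial>lborel) * (\<integral>\<^sup>+x. g x \<partial>lborel)"
      by (simp add: nn_integral_multc nn_integral_cmult nn_integral_lborel_reflect)
    finally show ?thesis
      using g_pos g_fin by (metis infinity_ennreal_def mult_divide_eq_ennreal)
  qed
  show ?thesis
  proof (rule measure_eqI)
    fix A assume "A \<in> sets (distr lborel borel R)"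
    then have [measurable]: "A \<in> sets borel" by simp
    show "emeasure (distr lborel borel R) A = emeasure lborel A"
      using main[of "indicator A"] by (simp flip: nn_integral_indicator add: nn_integral_distr)
  qed simp
qed

lemma
  fixes f :: "'a::euclidean_space \<Rightarrow> 'b::euclidean_space" and R :: "'a \<Rightarrow> 'a"
  assumes f: "f \<in> borel_measurable borel"
  shows lborel_integral_orthogonal:
      "orthogonal_transformation R \<Longrightarrow> (LINT x|lborel. f (R x)) = (LINT x|lborel. f x)"
    and lborel_integral_translation: "(LINT x|lborel. f (x + a)) = (LINT x|lborel. f x)"
    and lborel_integral_uminus: "(LINT x|lborel. f (- x)) = (LINT x|lborel. f x)"
proof -
  have *: "(LINT x|lborel. f (T x)) = (LINT x|lborel. f x)"
    if "distr lborel borel T = lborel" "T \<in> borel_measurable borel" for T :: "'a \<Rightarrow> 'a"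
    using integral_distr[of T lborel borel f] that f by simp
  have **: "(LINT x|lborel. f (T x)) = (LINT x|lborel. f x)"
    if T: "orthogonal_transformation T" for T :: "'a \<Rightarrow> 'a"
    using distr_lborel_orthogonal[OF T] orthogonal_transformation_linear[OF T]
    by (intro * borel_measurable_continuous_onI linear_continuous_on)
       (simp_all add: linear_conv_bounded_linear)
  show "orthogonal_transformation R \<Longrightarrow> (LINT x|lborel. f (R x)) = (LINT x|lborel. f x)"
    by (rule **)
  show "(LINT x|lborel. f (- x)) = (LINT x|lborel. f x)"
    by (rule **) (auto simp: orthogonal_transformation_neg)
  show "(LINT x|lborel. f (x + a)) = (LINT x|lborel. f x)"
    using lborel_affine[of 1 a] by (intro *) (auto simp: density_1 add.commute)
qed

section \<open>Integrals of products over the coordinates\<close>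

lemma
  fixes f :: "'a::euclidean_space \<Rightarrow> real \<Rightarrow> 'b::{real_normed_field,banach,second_countable_topology}"
  assumes f: "\<And>b. b \<in> Basis \<Longrightarrow> integrable lborel (f b)"
  shows integrable_lborel_prod: "integrable lborel (\<lambda>x. \<Prod>b\<in>Basis. f b (x \<bullet> b))"
    and integral_lborel_prod:
      "(LINT x|lborel. (\<Prod>b\<in>Basis. f b (x \<bullet> b))) = (\<Prod>b\<in>Basis. LINT x|lborel. f b x)"
proof -
  interpret product_sigma_finite "\<lambda>_::'a. lborel :: real measure" ..
  have [measurable]: "f b \<in> borel_measurable borel" if "b \<in> Basis" for b
    using f[OF that] by (auto dest: borel_measurable_integrable)
  have inner: "(\<Sum>c\<in>Basis. g c *\<^sub>R c) \<bullet> b = g b" if "b \<in> Basis" for b :: 'a and g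
    using that by simp
  show "integrable lborel (\<lambda>x. \<Prod>b\<in>Basis. f b (x \<bullet> b))"
    using product_integrable_prod[of Basis f] f
    by (subst lborel_eq) (simp add: integrable_distr_eq inner cong: prod.cong)
  show "(LINT x|lborel. (\<Prod>b\<in>Basis. f b (x \<bullet> b))) = (\<Prod>b\<in>Basis. LINT x|lborel. f b x)"
    using product_integral_prod[of Basis f] f
    by (subst lborel_eq) (simp add: integral_distr inner cong: prod.cong)
qed

lemma prod_Basis_vec:
  fixes x :: "real ^ 'n"
  shows "(\<Prod>b\<in>Basis. g b (x \<bullet> b)) = (\<Prod>i\<in>UNIV. g (axis i 1) (x $ i))"
proof -
  have "Basis = (\<lambda>i. axis i (1::real)) ` (UNIV :: 'n set)"
    by (auto simp: Basis_vec_def)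
  moreover have "inj (\<lambda>i::'n. axis i (1::real))"
    by (auto simp: inj_on_def axis_eq_axis)
  ultimately have "(\<Prod>b\<in>Basis. g b (x \<bullet> b))
      = prod ((\<lambda>b. g b (x \<bullet> b)) \<circ> (\<lambda>i. axis i 1)) UNIV"
    by (metis prod.reindex)
  then show ?thesis
    by (simp add: inner_axis o_def)
qed

lemma
  fixes f :: "'n::finite \<Rightarrow> real \<Rightarrow> 'b::{real_normed_field,banach,second_countable_topology}"
  assumes f: "\<And>i. integrable lborel (f i)"
  shows integrable_lborel_vec_prod: "integrable lborel (\<lambda>x::real^'n. \<Prod>i\<in>UNIV. f i (x $ i))"
    and integral_lborel_vec_prod:
      "(LINT x|lborel. (\<Prod>i\<in>UNIV. f i ((x :: real^'n) $ i))) = (\<Prod>i\<in>UNIV. LINT x|lborel. f i x)"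
proof -
  \<comment> \<open>Passes from coordinates to basis vectors. Whatever \<open>THE\<close> returns,
    \<open>F b\<close> is some \<open>f i\<close>, so integrability holds for every
    \<open>b\<close>.\<close>
  define F where "F b = f (THE i. b = axis i (1::real))" for b
  have F: "F (axis i 1) = f i" for i
    unfolding F_def by (rule arg_cong[of _ _ f], rule the_equality) (auto simp: axis_eq_axis)
  have int: "integrable lborel (F b)" for b
    unfolding F_def by (rule f)
  show "integrable lborel (\<lambda>x::real^'n. \<Prod>i\<in>UNIV. f i (x $ i))"
    using integrable_lborel_prod[of F] int by (simp add: prod_Basis_vec F)
  have "(\<Prod>b\<in>(Basis::(real^'n) set). LINT x|lborel. F b x) = (\<Prod>i\<in>UNIV. LINT x|lborel. f i x)"
    using prod_Basis_vec[of "\<lambda>b _. LINT x|lborel. F b x"] by (simp add: F)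
  then show "(LINT x|lborel. (\<Prod>i\<in>UNIV. f i ((x :: real^'n) $ i))) = (\<Prod>i\<in>UNIV. LINT x|lborel. f i x)"
    using integral_lborel_prod[of F] int by (simp add: prod_Basis_vec F)
qed

section \<open>Integer vectors and the unit cube\<close>

text \<open>Indexing by plain functions makes sums over integer vectors sums over a
  \<open>PiE\<close> set, which factor into one-dimensional sums.\<close>

definition of_int_vec :: "('n::finite \<Rightarrow> int) \<Rightarrow> real ^ 'n" where
  "of_int_vec m = (\<chi> i. of_int (m i))"

lemma of_int_vec_nth [simp]: "of_int_vec m $ i = of_int (m i)"
  by (simp add: of_int_vec_def)

lemma of_int_vec_eq_iff: "of_int_vec m = of_int_vec k \<longleftrightarrow> m = k"
  by (auto simp: vec_eq_iff)

lemma of_int_vec_eq_0_iff: "of_int_vec m = 0 \<longleftrightarrow> m = (\<lambda>_. 0)"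
  by (auto simp: vec_eq_iff)

lemma bij_betw_of_int_vec: "bij_betw of_int_vec UNIV int_vectors"
proof -
  have "x \<in> range of_int_vec" if x: "x \<in> int_vectors" for x :: "real ^ 'n"
  proof
    show "x = of_int_vec (\<lambda>i. \<lfloor>x $ i\<rfloor>)"
      using x by (auto simp: vec_eq_iff int_vectors_def elim!: Ints_cases)
  qed simp
  then show ?thesis
    by (auto simp: bij_betw_def inj_on_def of_int_vec_eq_iff int_vectors_def)
qed

lemma of_int_vec_in_int_vectors [simp]: "of_int_vec m \<in> int_vectors"
  by (simp add: int_vectors_def)

lemma
  fixes f :: "'n::finite \<Rightarrow> int \<Rightarrow> real"
  assumes f: "\<And>i. f i summable_on UNIV"
  shows summable_on_prod_int: "(\<lambda>m. \<Prod>i\<in>UNIV. f i (m i)) summable_on UNIV"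
    and infsum_prod_int: "(\<Sum>\<^sub>\<infinity>m. \<Prod>i\<in>UNIV. f i (m i)) = (\<Prod>i\<in>UNIV. \<Sum>\<^sub>\<infinity>j. f i j)"
proof -
  have abs: "Infinite_Set_Sum.abs_summable_on (f i) UNIV" for i
    using f[of i, THEN summable_on_iff_abs_summable_on_real[THEN iffD1]]
    unfolding abs_summable_equivalent .
  have *: "Infinite_Set_Sum.abs_summable_on (\<lambda>g. \<Prod>i\<in>UNIV. f i (g i)) (UNIV \<rightarrow>\<^sub>E UNIV)"
    using abs by (intro abs_summable_on_prod_PiE) auto
  then have "(\<lambda>g. norm (\<Prod>i\<in>UNIV. f i (g i))) summable_on UNIV"
    unfolding abs_summable_equivalent[symmetric] by (simp add: PiE_UNIV_domain)
  then show sum: "(\<lambda>m. \<Prod>i\<in>UNIV. f i (m i)) summable_on UNIV"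
    by (rule abs_summable_summable)
  show "(\<Sum>\<^sub>\<infinity>m. \<Prod>i\<in>UNIV. f i (m i)) = (\<Prod>i\<in>UNIV. \<Sum>\<^sub>\<infinity>j. f i j)"
    using infsum_prod_PiE[of "UNIV :: 'n set" f "\<lambda>_. UNIV"] f sum by (simp add: PiE_UNIV_domain)
qed

lemma summable_on_int_nonneg:
  fixes f :: "int \<Rightarrow> real"
  assumes "summable (\<lambda>n. f (int n))" "summable (\<lambda>n. f (- int n))" "\<And>j. f j \<ge> 0"
  shows "f summable_on UNIV"
proof -
  have nat: "f summable_on range int"
    using assms by (subst summable_on_reindex) (auto simp: o_def summable_on_UNIV_nonneg_real_iff)
  have neg: "f summable_on range (\<lambda>n. - int n)"
    using assms by (subst summable_on_reindex) (auto simp: o_def summable_on_UNIV_nonneg_real_iff inj_on_def)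
  have "j \<in> range int \<union> range (\<lambda>n. - int n)" for j
    by (cases j rule: int_cases2) auto
  then have "UNIV = range int \<union> range (\<lambda>n. - int n)"
    by blast
  then show ?thesis
    using summable_on_union[OF nat neg] by simp
qed

section \<open>A majorant that is both integrable and summable\<close>

lemma summable_on_inverse_square_int: "(\<lambda>j::int. 1 / (1 + (of_int j)\<^sup>2) :: real) summable_on UNIV"
proof -
  have "summable (\<lambda>n. 1 / (1 + (real n)\<^sup>2))"
  proof (rule summable_comparison_test')
    show "summable (\<lambda>n. inverse (real n ^ 2))"
      by (rule inverse_power_summable) simp
    fix n :: nat
    assume "n \<ge> 1"
    then have "1 / (1 + (real n)\<^sup>2) \<le> 1 / (real n)\<^sup>2"
      by (intro divide_left_mono mult_pos_pos) (simp_all add: add_pos_nonneg)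
    then show "norm (1 / (1 + (real n)\<^sup>2)) \<le> inverse ((real n)\<^sup>2)"
      by (simp add: inverse_eq_divide)
  qed
  then show ?thesis
    by (intro summable_on_int_nonneg) simp_all
qed

lemma integrable_inverse_square: "integrable lborel (\<lambda>x. 1 / (1 + x\<^sup>2) :: real)"
  using integrable_inverse_1_plus_square by (simp add: set_integrable_def inverse_eq_divide)

text \<open>The product form, rather than a power of the norm, lets both the integral and the
  lattice sum split into convergent one-dimensional factors.\<close>

definition decay :: "real ^ 'n \<Rightarrow> real" where
  "decay x = (\<Prod>i\<in>UNIV. 1 / (1 + (x $ i)\<^sup>2))"

lemma decay_pos: "decay x > 0"
  unfolding decay_def by (intro prod_pos) (simp add: add_pos_nonneg)

lemma integrable_decay: "integrable lborel decay"
  unfolding decay_def by (intro integrable_lborel_vec_prod integrable_inverse_square)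

lemma summable_on_decay: "(\<lambda>m. decay (of_int_vec m)) summable_on UNIV"
  unfolding decay_def of_int_vec_nth
  by (intro summable_on_prod_int summable_on_inverse_square_int)

text \<open>A shift inside the closed unit cube costs only a constant, so one summable majorant
  serves all points of a cell at once. Per coordinate,
  \<open>(a + b)\<^sup>2 \<le> 2 * a\<^sup>2 + 2 * b\<^sup>2\<close> leaves room for the factor
  4.\<close>

lemma decay_add_le:
  fixes x y :: "real ^ 'n"
  assumes "\<And>i. \<bar>y $ i\<bar> \<le> 1/2"
  shows "decay (x + y) \<le> 4 ^ CARD('n) * decay x"
proof -
  have "1 / (1 + (x $ i + y $ i)\<^sup>2) \<le> 4 * (1 / (1 + (x $ i)\<^sup>2))" for i
  proof -
    have y: "(y $ i)\<^sup>2 \<le> 1/4"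
      using power_mono[OF assms[of i], of 2] by (simp add: power_divide)
    define s where "s = x $ i + y $ i"
    have "(x $ i)\<^sup>2 \<le> 2 * s\<^sup>2 + 2 * (y $ i)\<^sup>2"
      using zero_le_power2[of "s + y $ i"] by (simp add: s_def power2_eq_square algebra_simps)
    then have "1 + (x $ i)\<^sup>2 \<le> 4 * (1 + s\<^sup>2)"
      using y zero_le_power2[of s] by argo
    then have "1 + (x $ i)\<^sup>2 \<le> 4 * (1 + (x $ i + y $ i)\<^sup>2)"
      by (simp add: s_def)
    then show ?thesis
      by (simp add: divide_simps add_pos_nonneg)
  qed
  then have "decay (x + y) \<le> (\<Prod>i\<in>(UNIV::'n set). 4 * (1 / (1 + (x $ i)\<^sup>2)))"
    unfolding decay_def by (intro prod_mono) simp
  then show ?thesis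
    by (simp only: prod.distrib decay_def prod_constant)
qed

text \<open>Half-open so that the integer translates tile without overlap, and centred so that the
  only integer point, where the Fejer kernel concentrates, is interior.\<close>

definition unit_cube :: "(real ^ 'n) set" where
  "unit_cube = {y. \<forall>i. - 1/2 \<le> y $ i \<and> y $ i < 1/2}"

lemma unit_cube_measurable [measurable]: "unit_cube \<in> sets borel"
  unfolding unit_cube_def by measurable

lemma indicator_unit_cube:
  "indicator unit_cube y = (\<Prod>i\<in>UNIV. indicator {- 1/2..<1/2} (y $ i) :: 'a::{comm_ring_1})"
proof (cases "y \<in> unit_cube")
  case False
  then obtain i where "indicator {- 1/2..<1/2} (y $ i) = (0 :: 'a)"
    by (auto simp: unit_cube_def indicator_def)
  then have "(\<Prod>i\<in>UNIV. indicator {- 1/2..<1/2} (y $ i) :: 'a) = 0"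
    by (metis UNIV_I finite prod_zero)
  then show ?thesis
    using False by simp
qed (auto simp: unit_cube_def indicator_def intro!: prod.neutral[symmetric])

lemma unit_cube_tile:
  fixes x :: "real ^ 'n"
  shows "\<exists>!m. x - of_int_vec m \<in> unit_cube"
proof
  show "x - of_int_vec (\<lambda>i. \<lfloor>x $ i + 1/2\<rfloor>) \<in> unit_cube"
  proof -
    have "- 1/2 \<le> x $ i - of_int \<lfloor>x $ i + 1/2\<rfloor> \<and> x $ i - of_int \<lfloor>x $ i + 1/2\<rfloor> < 1/2" for i
      using floor_correct[of "x $ i + 1/2"] by linarith
    then show ?thesis
      by (simp add: unit_cube_def)
  qed
next
  fix m assume m: "x - of_int_vec m \<in> unit_cube"
  show "m = (\<lambda>i. \<lfloor>x $ i + 1/2\<rfloor>)"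
  proof
    fix i
    have "- 1/2 \<le> x $ i - of_int (m i)" "x $ i - of_int (m i) < 1/2"
      using m by (auto simp: unit_cube_def)
    then show "m i = \<lfloor>x $ i + 1/2\<rfloor>"
      by (intro floor_unique[symmetric]) linarith+
  qed
qed

section \<open>Orthogonality of the characters on the unit cube\<close>

lemma integral_cis_unit:
  "(LINT x|lborel. indicator {- 1/2..<1/2} x * cis (2 * pi * of_int k * x)) = (if k = 0 then 1 else 0)"
proof -
  define c where "c = 2 * pi * \<i> * of_int k"
  have cis: "cis (2 * pi * of_int k * x) = exp (c * of_real x)" for x
    by (simp add: c_def cis_conv_exp mult_ac)
  have "(LINT x|lborel. indicator {- 1/2..<1/2} x * exp (c * of_real x))
      = (LINT x|lborel. indicator {- 1/2..1/2} x *\<^sub>R exp (c * of_real x))"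
  proof (rule integral_cong_AE)
    show "(\<lambda>x. indicator {- 1/2..<1/2} x * exp (c * of_real x)) \<in> borel_measurable lborel"
      by measurable
    show "(\<lambda>x. indicator {- 1/2..1/2} x *\<^sub>R exp (c * of_real x)) \<in> borel_measurable lborel"
      by measurable
    show "AE x in lborel. indicator {- 1/2..<1/2} x * exp (c * of_real x)
        = indicator {- 1/2..1/2} x *\<^sub>R exp (c * of_real x)"
      using AE_lborel_singleton[of "1/2 :: real"] by eventually_elim (auto simp: indicator_def)
  qed
  also have "\<dots> = (if k = 0 then 1 else 0)"
  proof (cases "k = 0")
    case True
    then show ?thesis
      by (simp add: c_def)
  next
    case False
    then have c: "c \<noteq> 0"
      by (simp add: c_def)
    define F where "F x = exp (c * of_real x) / c" for x :: real
    have F: "(F has_vector_derivative exp (c * of_real x)) (at x within A)" for x A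
      unfolding F_def using c
      by (intro has_vector_derivative_real_field[of "\<lambda>x. exp (c * x) / c"])
         (auto intro!: derivative_eq_intros)
    have "exp c = 1"
      using exp_integer_2pi[of "of_int k"] by (simp add: c_def mult_ac)
    then have "exp (c * of_real (1/2)) = exp (c * of_real (- 1/2))"
      using exp_add[of "c * of_real (- 1/2)" c] by (simp add: field_simps)
    then have "F (1/2) - F (- 1/2) = 0"
      by (simp add: F_def)
    moreover have "(LINT x|lborel. indicator {- 1/2..1/2} x *\<^sub>R exp (c * of_real x)) = F (1/2) - F (- 1/2)"
      by (intro integral_FTC_Icc F continuous_intros) auto
    ultimately show ?thesis
      using False by simp
  qed
  finally show ?thesis
    by (simp add: cis)
qed

text \<open>The complex exponential of an inner product factors over the coordinates while the
  cosine does not, so the computation is done with \<open>cis\<close> and real parts are taken at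
  the end.\<close>

lemma
  fixes k :: "'n::finite \<Rightarrow> int"
  shows integrable_cos_unit_cube:
      "integrable lborel (\<lambda>y. indicator unit_cube y * cos (2 * pi * (of_int_vec k \<bullet> y)))"
    and integral_cos_unit_cube:
      "(LINT y|lborel. indicator unit_cube y * cos (2 * pi * (of_int_vec k \<bullet> y)))
        = (if k = (\<lambda>_. 0) then 1 else 0)"
proof -
  let ?f = "\<lambda>i x. indicator {- 1/2..<1/2} x * cis (2 * pi * of_int (k i) * x)"
  let ?g = "\<lambda>y. indicator unit_cube y * cis (2 * pi * (of_int_vec k \<bullet> y))"
  have int: "integrable lborel (?f i)" for i
  proof (rule Bochner_Integration.integrable_bound[where f = "indicator {- 1/2..<1/2 :: real} :: _ \<Rightarrow> real"])
    show "?f i \<in> borel_measurable lborel"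
      unfolding cis_conv_exp by measurable
  qed (auto simp: norm_mult indicator_def)
  have prod: "(\<Prod>i\<in>UNIV. ?f i (y $ i)) = ?g y" for y :: "real ^ 'n"
    by (simp add: prod.distrib indicator_unit_cube inner_vec_def sum_distrib_left cis_conv_exp
        mult_ac flip: exp_sum)
  have Re: "Re (?g y) = indicator unit_cube y * cos (2 * pi * (of_int_vec k \<bullet> y))" for y
    by (simp add: indicator_def)
  have g: "integrable lborel ?g"
    using integrable_lborel_vec_prod[of ?f, OF int] by (simp only: prod)
  show "integrable lborel (\<lambda>y. indicator unit_cube y * cos (2 * pi * (of_int_vec k \<bullet> y)))"
    using integrable_Re[OF g] by (simp only: Re)
  have *: "(\<Prod>i\<in>UNIV. if k i = 0 then 1 else 0) = (if k = (\<lambda>_. 0) then 1 else (0::complex))"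
    by (auto simp: fun_eq_iff)
  have "integral\<^sup>L lborel ?g = (if k = (\<lambda>_. 0) then 1 else 0)"
    using integral_lborel_vec_prod[of ?f, OF int] by (simp only: prod integral_cis_unit *)
  then show "(LINT y|lborel. indicator unit_cube y * cos (2 * pi * (of_int_vec k \<bullet> y)))
      = (if k = (\<lambda>_. 0) then 1 else 0)"
    using integral_Re[OF g] by (simp only: Re split: if_splits) simp_all
qed

section \<open>Poisson summation through the Fejer kernel\<close>

lemma of_int_vec_diff: "of_int_vec a - of_int_vec b = of_int_vec (\<lambda>i. a i - b i)"
  by (simp add: vec_eq_iff)

lemma inner_of_int_vec: "of_int_vec a \<bullet> of_int_vec b = of_int (\<Sum>i\<in>UNIV. a i * b i)"
  by (simp add: inner_vec_def)

definition fejer_index :: "nat \<Rightarrow> ('n::finite \<Rightarrow> int) set" where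
  "fejer_index N = UNIV \<rightarrow>\<^sub>E {0..<int N}"

text \<open>This is the product of the one-dimensional Fejer kernels, that is, the squared modulus
  of the sum of the characters with frequency in the box, divided by \<open>N ^ CARD('n)\<close>. In
  the expanded cosine form, integrating against it gives a finite average of Fourier
  coefficients.\<close>

definition fejer :: "nat \<Rightarrow> real ^ 'n \<Rightarrow> real" where
  "fejer N y = (\<Sum>a\<in>fejer_index N. \<Sum>b\<in>fejer_index N.
      cos (2 * pi * (of_int_vec (\<lambda>i. a i - b i) \<bullet> y))) / real N ^ CARD('n)"

lemma fejer_index_iff: "a \<in> fejer_index N \<longleftrightarrow> (\<forall>j. 0 \<le> a j \<and> a j < int N)"
  by (simp add: fejer_index_def PiE_iff)

lemma finite_fejer_index [simp]: "finite (fejer_index N)"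
  unfolding fejer_index_def by (intro finite_PiE) auto

lemma card_fejer_index: "card (fejer_index N :: ('n::finite \<Rightarrow> int) set) = N ^ CARD('n)"
  by (simp add: fejer_index_def card_PiE)

lemma fejer_nonneg: "fejer N y \<ge> 0"
proof -
  let ?p = "\<lambda>a. 2 * pi * (of_int_vec a \<bullet> y)"
  have "cos (2 * pi * (of_int_vec (\<lambda>i. a i - b i) \<bullet> y)) = cos (?p a) * cos (?p b) + sin (?p a) * sin (?p b)"
    for a b
    by (simp add: inner_diff_left algebra_simps cos_diff flip: of_int_vec_diff)
  then have "(\<Sum>a\<in>fejer_index N. \<Sum>b\<in>fejer_index N. cos (2 * pi * (of_int_vec (\<lambda>i. a i - b i) \<bullet> y)))
      = (\<Sum>a\<in>fejer_index N. cos (?p a))\<^sup>2 + (\<Sum>a\<in>fejer_index N. sin (?p a))\<^sup>2"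
    by (simp add: sum.distrib power2_eq_square sum_product)
  then show ?thesis
    unfolding fejer_def by simp
qed

lemma fejer_periodic: "fejer N (of_int_vec m + y) = fejer N y"
proof -
  have "cos (2 * pi * (of_int_vec k \<bullet> (of_int_vec m + y))) = cos (2 * pi * (of_int_vec k \<bullet> y))" for k
    unfolding inner_add_right inner_of_int_vec distrib_left
    by (simp add: cos_add del: of_int_sum of_int_mult)
  then show ?thesis
    by (simp add: fejer_def)
qed

lemma fejer_measurable [measurable]: "fejer N \<in> borel_measurable borel"
  unfolding fejer_def by measurable

lemma
  fixes f :: "real ^ 'n \<Rightarrow> real"
  assumes f: "\<And>k. integrable lborel (\<lambda>y. f y * cos (2 * pi * (of_int_vec k \<bullet> y)))"
  shows integrable_mult_fejer: "integrable lborel (\<lambda>y. f y * fejer N y)"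
    and integral_mult_fejer: "(LINT y|lborel. f y * fejer N y)
      = (\<Sum>a\<in>fejer_index N. \<Sum>b\<in>fejer_index N.
          LINT y|lborel. f y * cos (2 * pi * (of_int_vec (\<lambda>i. a i - b i) \<bullet> y))) / real N ^ CARD('n)"
proof -
  have *: "(\<lambda>y. f y * fejer N y) = (\<lambda>y. (\<Sum>a\<in>fejer_index N. \<Sum>b\<in>fejer_index N.
        f y * cos (2 * pi * (of_int_vec (\<lambda>i. a i - b i) \<bullet> y))) / real N ^ CARD('n))"
    by (simp add: fejer_def sum_distrib_left)
  show "integrable lborel (\<lambda>y. f y * fejer N y)"
    unfolding * by (intro Bochner_Integration.integrable_divide Bochner_Integration.integrable_sum f)
  show "(LINT y|lborel. f y * fejer N y)
      = (\<Sum>a\<in>fejer_index N. \<Sum>b\<in>fejer_index N.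
          LINT y|lborel. f y * cos (2 * pi * (of_int_vec (\<lambda>i. a i - b i) \<bullet> y))) / real N ^ CARD('n)"
    unfolding * by (simp add: Bochner_Integration.integral_sum Bochner_Integration.integrable_sum f)
qed

lemma
  shows integrable_fejer_unit_cube: "integrable lborel (\<lambda>y::real^'n. indicator unit_cube y * fejer N y)"
    and integral_fejer_unit_cube: "N > 0 \<Longrightarrow> (LINT y|lborel. indicator unit_cube (y::real^'n) * fejer N y) = 1"
proof -
  show "integrable lborel (\<lambda>y::real^'n. indicator unit_cube y * fejer N y)"
    by (intro integrable_mult_fejer integrable_cos_unit_cube)
  have eq: "(\<lambda>i. a i - b i) = (\<lambda>_. 0) \<longleftrightarrow> b = a" for a b :: "'n \<Rightarrow> int"
    by (auto simp: fun_eq_iff)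
  show "(LINT y|lborel. indicator unit_cube (y::real^'n) * fejer N y) = 1" if "N > 0"
    using that by (subst integral_mult_fejer[OF integrable_cos_unit_cube])
      (simp add: integral_cos_unit_cube eq sum.delta card_fejer_index)
qed

text \<open>Counts the index pairs of the kernel whose difference is the unit vector in direction
  \<open>i\<close>. The shift must stay in the box, which costs one value of the coordinate
  \<open>i\<close>.\<close>

lemma card_fejer_index_shift:
  fixes i :: "'n::finite"
  assumes "N > 0"
  shows "card {a \<in> fejer_index N. a(i := a i + 1) \<in> fejer_index N} = (N - 1) * N ^ (CARD('n) - 1)"
proof -
  have "{a \<in> fejer_index N. a(i := a i + 1) \<in> fejer_index N}
      = (\<Pi>\<^sub>E j\<in>UNIV. if j = i then {0..<int N - 1} else {0..<int N})"
  proof (intro set_eqI iffI)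
    fix a assume "a \<in> {a \<in> fejer_index N. a(i := a i + 1) \<in> fejer_index N}"
    then have "\<And>j. 0 \<le> a j \<and> a j < int N" "a i + 1 < int N"
      unfolding fejer_index_iff mem_Collect_eq by (auto dest: spec[of _ i])
    then show "a \<in> (\<Pi>\<^sub>E j\<in>UNIV. if j = i then {0..<int N - 1} else {0..<int N})"
      by (simp add: PiE_iff)
  next
    fix a assume "a \<in> (\<Pi>\<^sub>E j\<in>UNIV. if j = i then {0..<int N - 1} else {0..<int N})"
    then have a: "a j \<in> (if j = i then {0..<int N - 1} else {0..<int N})" for j
      by (simp add: PiE_iff)
    have "0 \<le> a j \<and> a j < int N" "0 \<le> (a(i := a i + 1)) j \<and> (a(i := a i + 1)) j < int N" for j
      using a[of j] by (auto split: if_splits)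
    then show "a \<in> {a \<in> fejer_index N. a(i := a i + 1) \<in> fejer_index N}"
      unfolding fejer_index_iff mem_Collect_eq by blast
  qed
  then have "card {a \<in> fejer_index N. a(i := a i + 1) \<in> fejer_index N}
      = (\<Prod>j\<in>UNIV. if j = i then N - 1 else N)"
    using assms by (simp add: card_PiE nat_diff_distrib if_distrib[of card] cong: if_cong)
  also have "\<dots> = (N - 1) * (\<Prod>j\<in>UNIV - {i}. N)"
    by (subst prod.remove[of _ i]) auto
  finally show ?thesis
    by (simp add: card_Diff_singleton)
qed

text \<open>The value is the Fejer weight of a unit frequency. By the product formula for cosines
  both signs of that frequency occur with weight 1/2, each for
  \<open>(N - 1) * N ^ (CARD('n) - 1)\<close> index pairs.\<close>

lemma
  fixes i :: "'n::finite"
  shows integrable_fejer_cos: "integrable lborel (\<lambda>y. indicator unit_cube y * cos (2 * pi * y $ i) * fejer N y)"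
    and integral_fejer_cos:
      "N > 0 \<Longrightarrow> (LINT y|lborel. indicator unit_cube y * cos (2 * pi * y $ i) * fejer N y) = 1 - 1 / real N"
proof -
  let ?d = "\<lambda>j. if j = i then 1 else 0 :: int"
  have yi: "y $ i = of_int_vec ?d \<bullet> y" for y :: "real ^ 'n"
    by (simp add: inner_vec_def if_distrib[of of_int] if_distrib[of "\<lambda>c. c * _"] cong: if_cong)
  have prod: "indicator unit_cube y * cos (2 * pi * y $ i) * cos (2 * pi * (of_int_vec k \<bullet> y))
      = (indicator unit_cube y * cos (2 * pi * (of_int_vec (\<lambda>j. k j - ?d j) \<bullet> y))
        + indicator unit_cube y * cos (2 * pi * (of_int_vec (\<lambda>j. k j + ?d j) \<bullet> y))) / 2" for k and y :: "real ^ 'n"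
  proof -
    have "of_int_vec (\<lambda>j. k j + ?d j) = of_int_vec k + of_int_vec ?d"
      by (simp add: vec_eq_iff)
    then show ?thesis
      unfolding yi by (simp add: of_int_vec_diff[symmetric] inner_diff_left inner_add_left
          right_diff_distrib distrib_left cos_add cos_diff algebra_simps)
  qed
  have int: "integrable lborel (\<lambda>y. indicator unit_cube y * cos (2 * pi * y $ i) * cos (2 * pi * (of_int_vec k \<bullet> y)))" for k
    unfolding prod by (intro Bochner_Integration.integrable_divide Bochner_Integration.integrable_add integrable_cos_unit_cube)
  show "integrable lborel (\<lambda>y. indicator unit_cube y * cos (2 * pi * y $ i) * fejer N y)"
    by (rule integrable_mult_fejer) (rule int)
  assume N: "N > 0"
  have eq1: "(\<lambda>j. a j - b j - ?d j) = (\<lambda>_. 0) \<longleftrightarrow> a = b(i := b i + 1)" for a b :: "'n \<Rightarrow> int"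
    by (auto simp: fun_eq_iff algebra_simps)
  have eq2: "(\<lambda>j. a j - b j + ?d j) = (\<lambda>_. 0) \<longleftrightarrow> b = a(i := a i + 1)" for a b :: "'n \<Rightarrow> int"
    by (auto simp: fun_eq_iff algebra_simps)
  have val: "(LINT y|lborel. indicator unit_cube y * cos (2 * pi * y $ i) * cos (2 * pi * (of_int_vec (\<lambda>j. a j - b j) \<bullet> y)))
      = ((if a = b(i := b i + 1) then 1 else 0) + (if b = a(i := a i + 1) then 1 else 0)) / 2" for a b
    unfolding prod
    by (simp add: integrable_cos_unit_cube integral_cos_unit_cube eq1 eq2)
  let ?E = "{a \<in> fejer_index N. a(i := a i + 1) \<in> fejer_index N}"
  have sum2: "(\<Sum>a\<in>fejer_index N. \<Sum>b\<in>fejer_index N. if b = a(i := a i + 1) then 1 else 0 :: real) = card ?E"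
    by (simp add: sum.delta sum.inter_filter[symmetric])
  have sum1: "(\<Sum>a\<in>fejer_index N. \<Sum>b\<in>fejer_index N. if a = b(i := b i + 1) then 1 else 0 :: real) = card ?E"
    unfolding sum2[symmetric] by (rule sum.swap)
  have "(LINT y|lborel. indicator unit_cube y * cos (2 * pi * y $ i) * fejer N y)
      = real (card ?E) / real N ^ CARD('n)"
    by (subst integral_mult_fejer[OF int])
       (simp only: val sum.distrib add_divide_distrib sum_divide_distrib[symmetric] sum1 sum2; simp)
  also have "\<dots> = (real N - 1) * real N ^ (CARD('n) - 1) / (real N * real N ^ (CARD('n) - 1))"
    using N by (simp add: card_fejer_index_shift of_nat_diff power_eq_if[of _ "CARD('n)"])
  also have "\<dots> = 1 - 1 / real N"
    using N by (simp add: field_simps)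
  finally show "(LINT y|lborel. indicator unit_cube y * cos (2 * pi * y $ i) * fejer N y) = 1 - 1 / real N" .
qed

text \<open>Only \<open>1 - cos (2 * pi * y $ i)\<close> is needed as a test function (Korovkin), since it
  controls \<open>u y - u 0\<close> away from the origin of the cube.\<close>
lemma fejer_tendsto:
  fixes u :: "real ^ 'n \<Rightarrow> real"
  assumes [measurable]: "u \<in> borel_measurable borel" and cont: "isCont u 0"
    and B: "\<And>y. y \<in> unit_cube \<Longrightarrow> \<bar>u y\<bar> \<le> B"
  shows "(\<lambda>N. LINT y|lborel. indicator unit_cube y * (u y * fejer N y)) \<longlonglongrightarrow> u 0"
proof (rule tendstoI)
  fix e :: real assume "e > 0"
  define d where "d = e / 2"
  have "d > 0" using \<open>e > 0\<close> by (simp add: d_def)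
  obtain r where r: "r > 0" "\<And>y. norm y < r \<Longrightarrow> \<bar>u y - u 0\<bar> < d"
    using cont \<open>d > 0\<close> unfolding continuous_at_eps_delta by (auto simp: dist_norm)
  \<comment> \<open>The second bound puts every \<open>y\<close> with all coordinates below
    \<open>\<delta>\<close> into the ball of radius \<open>r\<close>, by the l1 estimate of the
    norm. The first keeps \<open>2 * pi * \<delta>\<close> in the range where the cosine
    decreases.\<close>
  define \<delta> where "\<delta> = min (1/2) (r / (2 * CARD('n)))"
  have \<delta>: "0 < \<delta>" "\<delta> \<le> 1/2"
    using r(1) by (auto simp: \<delta>_def)
  define c where "c = 1 - cos (2 * pi * \<delta>)"
  have "cos (2 * pi * \<delta>) < cos 0"
    using \<delta> by (intro cos_monotone_0_pi) (auto simp: field_simps)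
  then have c: "c > 0"
    by (simp add: c_def)
  have B0: "B \<ge> 0"
    using B[of 0] by (simp add: unit_cube_def)
  \<comment> \<open>Away from the origin of the cube some summand of \<open>w\<close> is at least
    \<open>c\<close>, so \<open>C * w y\<close> exceeds the trivial bound \<open>2 * B\<close>
    there.\<close>
  define C where "C = 2 * B / c"
  have C: "C \<ge> 0"
    using B0 c by (simp add: C_def)
  define w where "w y = (\<Sum>i\<in>UNIV. 1 - cos (2 * pi * y $ i))" for y :: "real ^ 'n"
  have w_nonneg: "w y \<ge> 0" for y
    unfolding w_def by (intro sum_nonneg) simp
  have bound: "\<bar>u y - u 0\<bar> \<le> d + C * w y" if y: "y \<in> unit_cube" for y
  proof (cases "\<forall>i. \<bar>y $ i\<bar> < \<delta>")
    case True
    have "norm y \<le> (\<Sum>i\<in>UNIV. \<bar>y $ i\<bar>)"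
      by (rule norm_le_l1_cart)
    also have "\<dots> \<le> (\<Sum>i\<in>(UNIV::'n set). r / (2 * CARD('n)))"
      using True by (intro sum_mono) (auto simp: \<delta>_def intro: less_imp_le)
    also have "\<dots> < r"
      using r(1) by simp
    finally have "\<bar>u y - u 0\<bar> < d"
      by (rule r(2))
    moreover have "C * w y \<ge> 0"
      using C w_nonneg by simp
    ultimately show ?thesis by linarith
  next
    case False
    then obtain i where i: "\<bar>y $ i\<bar> \<ge> \<delta>" by (auto simp: not_less)
    have "\<bar>y $ i\<bar> \<le> 1/2"
      using y unfolding unit_cube_def mem_Collect_eq by (metis abs_le_iff less_imp_le minus_divide_left minus_le_iff)
    then have "cos \<bar>2 * pi * y $ i\<bar> \<le> cos (2 * pi * \<delta>)"
      using i \<delta> by (intro cos_monotone_0_pi_le) (auto simp: abs_mult field_simps)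
    then have "c \<le> 1 - cos (2 * pi * y $ i)"
      by (simp add: c_def)
    also have "\<dots> \<le> w y"
      unfolding w_def by (rule member_le_sum) auto
    finally have "2 * B \<le> C * w y"
      using c B0 unfolding C_def by (simp add: pos_le_divide_eq mult_left_mono)
    moreover have "\<bar>u y - u 0\<bar> \<le> 2 * B"
      using B[OF y] B[of 0] by (simp add: unit_cube_def)
    ultimately show ?thesis
      using \<open>d > 0\<close> by linarith
  qed
  have fejer_int: "integrable lborel (\<lambda>y::real^'n. indicator unit_cube y * fejer N y)" for N
    by (rule integrable_fejer_unit_cube)
  have w_eq: "indicator unit_cube y * (w y * fejer N y)
      = (\<Sum>i\<in>UNIV. indicator unit_cube y * fejer N y
          - indicator unit_cube y * cos (2 * pi * y $ i) * fejer N y)" for N y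
    by (simp add: w_def sum_distrib_left sum_distrib_right algebra_simps)
  have w_int: "integrable lborel (\<lambda>y. indicator unit_cube y * (w y * fejer N y))" for N
    unfolding w_eq
    by (intro Bochner_Integration.integrable_sum Bochner_Integration.integrable_diff
        fejer_int integrable_fejer_cos)
  have w_val: "(LINT y|lborel. indicator unit_cube y * (w y * fejer N y)) = CARD('n) / real N"
    if "N > 0" for N
    unfolding w_eq using that
    by (simp add: Bochner_Integration.integral_sum Bochner_Integration.integral_diff fejer_int
        integrable_fejer_cos integral_fejer_unit_cube integral_fejer_cos)
  have u_int: "integrable lborel (\<lambda>y. indicator unit_cube y * (u y * fejer N y))" for N
  proof (rule Bochner_Integration.integrable_bound)
    show "integrable lborel (\<lambda>y::real^'n. B * (indicator unit_cube y * fejer N y))"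
      by (intro integrable_mult_right fejer_int)
    show "AE y in lborel. norm (indicator unit_cube y * (u y * fejer N y))
        \<le> norm (B * (indicator unit_cube y * fejer N y))"
      using B B0 fejer_nonneg by (auto simp: indicator_def abs_mult intro!: mult_right_mono)
  qed measurable
  have est: "\<bar>(LINT y|lborel. indicator unit_cube y * (u y * fejer N y)) - u 0\<bar> \<le> d + C * (CARD('n) / real N)"
    if N: "N > 0" for N
  proof -
    have "(LINT y|lborel. indicator unit_cube y * (u y * fejer N y)) - u 0
        = (LINT y|lborel. indicator unit_cube y * (u y * fejer N y) - u 0 * (indicator unit_cube y * fejer N y))"
      using N by (simp add: Bochner_Integration.integral_diff u_int fejer_int integral_fejer_unit_cube)
    also have "\<bar>\<dots>\<bar> \<le> (LINT y|lborel. d * (indicator unit_cube y * fejer N y)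
        + C * (indicator unit_cube y * (w y * fejer N y)))"
    proof (rule integral_abs_bound[THEN order_trans], rule integral_mono)
      show "integrable lborel (\<lambda>y. \<bar>indicator unit_cube y * (u y * fejer N y) - u 0 * (indicator unit_cube y * fejer N y)\<bar>)"
        by (intro integrable_abs Bochner_Integration.integrable_diff u_int integrable_mult_right fejer_int)
      show "integrable lborel (\<lambda>y. d * (indicator unit_cube y * fejer N y)
        + C * (indicator unit_cube y * (w y * fejer N y)))"
        by (intro Bochner_Integration.integrable_add integrable_mult_right fejer_int w_int)
      fix y :: "real ^ 'n"
      have "\<bar>u y - u 0\<bar> * fejer N y \<le> (d + C * w y) * fejer N y" if "y \<in> unit_cube"
        using bound[OF that] fejer_nonneg by (rule mult_right_mono)
      moreover have "\<bar>u y * fejer N y - u 0 * fejer N y\<bar> = \<bar>u y - u 0\<bar> * fejer N y"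
        using fejer_nonneg[of N y] by (simp add: abs_mult flip: left_diff_distrib)
      ultimately show "\<bar>indicator unit_cube y * (u y * fejer N y) - u 0 * (indicator unit_cube y * fejer N y)\<bar>
          \<le> d * (indicator unit_cube y * fejer N y) + C * (indicator unit_cube y * (w y * fejer N y))"
        by (cases "y \<in> unit_cube") (simp_all add: algebra_simps)
    qed
    also have "\<dots> = d + C * (CARD('n) / real N)"
      using N by (simp add: Bochner_Integration.integral_add fejer_int w_int w_val integral_fejer_unit_cube)
    finally show ?thesis .
  qed
  have "(\<lambda>N. C * (CARD('n) / real N)) \<longlonglongrightarrow> 0"
    by (intro tendsto_mult_right_zero lim_const_over_n)
  then have "\<forall>\<^sub>F N in sequentially. C * (CARD('n) / real N) < d"
    using \<open>d > 0\<close> by (rule order_tendstoD)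
  then show "\<forall>\<^sub>F N in sequentially.
      dist (LINT y|lborel. indicator unit_cube y * (u y * fejer N y)) (u 0) < e"
    using eventually_gt_at_top[of 0]
  proof eventually_elim
    case (elim N)
    then show ?case
      using est[of N] unfolding dist_real_def d_def by argo
  qed
qed

text \<open>The Fejer kernel is concentrated at the integer points, so this is the Cesaro form of
  Poisson summation; it needs no decay of the Fourier transform.\<close>
lemma fejer_poisson:
  fixes f :: "real ^ 'n \<Rightarrow> real"
  assumes cont: "continuous_on UNIV f" and bound: "\<And>x. \<bar>f x\<bar> \<le> C * decay x"
  shows "(\<lambda>m. f (of_int_vec m)) summable_on UNIV"
    and "(\<lambda>N. LINT y|lborel. f y * fejer N y) \<longlonglongrightarrow> (\<Sum>\<^sub>\<infinity>m. f (of_int_vec m))"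
proof -
  have [measurable]: "f \<in> borel_measurable borel"
    using cont by (rule borel_measurable_continuous_onI)
  have isCont: "isCont f x" for x
    using cont by (simp add: continuous_on_eq_continuous_at)
  have "0 \<le> \<bar>f 0\<bar>" by simp
  also have "\<dots> \<le> C * decay (0 :: real^'n)" by (rule bound)
  finally have C: "C \<ge> 0"
    using decay_pos[of "0 :: real^'n"] by (simp add: zero_le_mult_iff)
  have abs_sum: "(\<lambda>m. \<bar>f (of_int_vec m)\<bar>) summable_on UNIV"
    by (rule summable_on_comparison_test[of "\<lambda>m. C * decay (of_int_vec m)"])
       (auto intro: summable_on_cmult_right summable_on_decay bound)
  then show sum: "(\<lambda>m. f (of_int_vec m)) summable_on UNIV"
    using abs_summable_summable[of "\<lambda>m. f (of_int_vec m)" UNIV] by simp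
  \<comment> \<open>A bound for \<open>f\<close> on the whole cell around the integer vector
    \<open>m\<close>; its summability later allows the limit in \<open>N\<close> to be taken cell by
    cell.\<close>
  define M where "M m = C * 4 ^ CARD('n) * decay (of_int_vec m :: real ^ 'n)" for m
  have M: "\<bar>f (of_int_vec m + y)\<bar> \<le> M m" if "y \<in> unit_cube" for m y
  proof -
    have "\<bar>y $ i\<bar> \<le> 1/2" for i
      using that unfolding unit_cube_def mem_Collect_eq by (metis abs_le_iff less_imp_le minus_divide_left minus_le_iff)
    then have "C * decay (of_int_vec m + y) \<le> C * (4 ^ CARD('n) * decay (of_int_vec m))"
      using C by (intro mult_left_mono decay_add_le)
    then show ?thesis
      using bound[of "of_int_vec m + y"] by (simp add: M_def mult_ac)
  qed
  have f_int: "integrable lborel f"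
  proof (rule Bochner_Integration.integrable_bound)
    show "integrable lborel (\<lambda>x::real^'n. C * decay x)"
      by (intro integrable_mult_right integrable_decay)
    show "AE x in lborel. norm (f x) \<le> norm (C * decay x)"
      unfolding real_norm_def by (intro AE_I2 order_trans[OF bound abs_ge_self])
  qed measurable
  have cos_int: "integrable lborel (\<lambda>y. f y * cos (2 * pi * (of_int_vec k \<bullet> y)))" for k
    by (rule Bochner_Integration.integrable_bound[OF f_int]) (auto simp: abs_mult mult_left_le)
  note f_fejer_int = integrable_mult_fejer[OF cos_int]
  \<comment> \<open>Countable additivity and Tannery's theorem are applied to sequences, hence the
    enumeration of the integer vectors.\<close>
  define e :: "nat \<Rightarrow> 'n \<Rightarrow> int" where "e = from_nat_into UNIV"
  have "infinite (UNIV :: ('n \<Rightarrow> int) set)"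
    using finite_range_imageI by (simp add: finite_UNIV_fun infinite_UNIV_int)
  then have e: "bij_betw e UNIV UNIV"
    unfolding e_def by (intro bij_betw_from_nat_into) auto
  define A where "A i = {x. x - of_int_vec (e i) \<in> unit_cube}" for i
  have A_sets [measurable]: "A i \<in> sets borel" for i
    unfolding A_def by measurable
  have "x \<in> (\<Union>i. A i)" for x
  proof -
    obtain m where m: "x - of_int_vec m \<in> unit_cube"
      using unit_cube_tile by metis
    moreover obtain i where "e i = m"
      using e by (metis bij_betw_def UNIV_I image_iff)
    ultimately show ?thesis
      by (auto simp: A_def)
  qed
  then have A_UN: "(\<Union>i. A i) = UNIV"
    by blast
  have A_disj: "A i \<inter> A j = {}" if "i \<noteq> j" for i j
  proof (rule ccontr)
    assume "A i \<inter> A j \<noteq> {}"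
    then obtain x where "x - of_int_vec (e i) \<in> unit_cube" "x - of_int_vec (e j) \<in> unit_cube"
      by (auto simp: A_def)
    then have "e i = e j"
      using unit_cube_tile by metis
    then show False
      using e that by (metis bij_betw_def inj_eq)
  qed
  define a where "a i N = (LINT y|lborel. indicator unit_cube y * (f (of_int_vec (e i) + y) * fejer N y))" for i N
  \<comment> \<open>Cutting space into the cells \<open>A i\<close> and translating each to the unit
    cube leaves the kernel unchanged, since it is periodic.\<close>
  have unfold: "(LINT y|lborel. f y * fejer N y) = (\<Sum>i. a i N)" for N
  proof -
    have "(LINT y|lborel. f y * fejer N y) = (LINT y:(\<Union>i. A i)|lborel. f y * fejer N y)"
      by (simp add: A_UN set_lebesgue_integral_def)
    also have "\<dots> = (\<Sum>i. LINT y:A i|lborel. f y * fejer N y)"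
      by (rule lebesgue_integral_countable_add) (simp_all add: A_disj A_UN set_integrable_def f_fejer_int)
    also have "(\<lambda>i. LINT y:A i|lborel. f y * fejer N y) = (\<lambda>i. a i N)"
    proof
      fix i
      have "(LINT y:A i|lborel. f y * fejer N y)
          = (LINT y|lborel. indicator (A i) (y + of_int_vec (e i))
              * (f (y + of_int_vec (e i)) * fejer N (y + of_int_vec (e i))))"
        unfolding set_lebesgue_integral_def
        by (subst lborel_integral_translation[symmetric, of _ "of_int_vec (e i)"]) simp_all
      also have "\<dots> = a i N"
        unfolding a_def
        by (intro Bochner_Integration.integral_cong)
           (auto simp: A_def indicator_def add.commute[of _ "of_int_vec _"] fejer_periodic)
      finally show "(LINT y:A i|lborel. f y * fejer N y) = a i N" .
    qed
    finally show ?thesis .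
  qed
  have lim: "(\<lambda>N. a i N) \<longlonglongrightarrow> f (of_int_vec (e i))" for i
    using fejer_tendsto[of "\<lambda>y. f (of_int_vec (e i) + y)" "M (e i)"] M
    unfolding a_def by (simp add: isCont isCont_o2[where g = f])
  have a_bound: "norm (a i N) \<le> M (e i)" if "N > 0" for i N
  proof -
    have M_int: "integrable lborel (\<lambda>y::real^'n. M (e i) * (indicator unit_cube y * fejer N y))"
      by (intro integrable_mult_right integrable_fejer_unit_cube)
    have ptw: "norm (indicator unit_cube y * (f (of_int_vec (e i) + y) * fejer N y))
        \<le> M (e i) * (indicator unit_cube y * fejer N y)" for y
      using M[of y "e i"] fejer_nonneg[of N y]
      by (cases "y \<in> unit_cube") (auto simp: abs_mult intro!: mult_right_mono)
    have "norm (a i N) \<le> (LINT y|lborel. M (e i) * (indicator unit_cube (y::real^'n) * fejer N y))"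
      unfolding a_def
      by (rule Bochner_Integration.integral_norm_bound_integral[OF _ M_int ptw])
         (rule Bochner_Integration.integrable_bound[OF M_int], measurable,
          rule AE_I2, rule order_trans[OF ptw], simp only: real_norm_def abs_ge_self)
    also have "\<dots> = M (e i)"
      using that by (simp add: integral_fejer_unit_cube)
    finally show ?thesis .
  qed
  have "(\<lambda>i. M (e i)) summable_on UNIV"
    using summable_on_reindex_bij_betw[OF e, of M] unfolding M_def
    by (simp add: summable_on_cmult_right summable_on_decay)
  then have M_sum: "summable (\<lambda>i. M (e i))"
    by (rule summable_on_imp_summable)
  have "(\<lambda>N. \<Sum>i. a i N) \<longlonglongrightarrow> (\<Sum>i. f (of_int_vec (e i)))"
  proof (rule tannerys_theorem[THEN conjunct2, THEN conjunct2, OF lim _ M_sum])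
    have "\<forall>\<^sub>F N in sequentially. \<forall>i. norm (a i N) \<le> M (e i)"
      using eventually_gt_at_top[of 0] by eventually_elim (use a_bound in blast)
    then show "\<forall>\<^sub>F (i, N) in at_top \<times>\<^sub>F at_top. norm (a i N) \<le> M (e i)"
      unfolding eventually_prod_filter
      by (intro exI[of _ "\<lambda>_. True"] exI[of _ "\<lambda>N. \<forall>i. norm (a i N) \<le> M (e i)"]) auto
  qed simp
  moreover have "(\<Sum>\<^sub>\<infinity>m. f (of_int_vec m)) = (\<Sum>i. f (of_int_vec (e i)))"
  proof -
    have "(\<lambda>i. f (of_int_vec (e i))) summable_on UNIV"
      using summable_on_reindex_bij_betw[OF e, of "\<lambda>m. f (of_int_vec m)"] sum by simp
    then have "(\<lambda>i. f (of_int_vec (e i))) sums (\<Sum>\<^sub>\<infinity>i. f (of_int_vec (e i)))"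
      by (intro has_sum_imp_sums has_sum_infsum)
    then show ?thesis
      using infsum_reindex_bij_betw[OF e, of "\<lambda>m. f (of_int_vec m)"] by (simp add: sums_iff)
  qed
  ultimately show "(\<lambda>N. LINT y|lborel. f y * fejer N y) \<longlonglongrightarrow> (\<Sum>\<^sub>\<infinity>m. f (of_int_vec m))"
    by (simp add: unfold)
qed

text \<open>By \<open>neg\<close> the terms of the Fejer average at shift 0 that belong to nonzero
  frequencies all have one sign, and they dominate in absolute value the corresponding terms at any
  shift \<open>s\<close>. With \<open>ge\<close> their average must tend to 0, hence so does the
  average at \<open>s\<close>, and every translate sees only the zero frequency.\<close>

lemma poisson_extremal:
  fixes g :: "real ^ 'n \<Rightarrow> real"
  assumes cont: "continuous_on UNIV g" and bound: "\<And>x. \<bar>g x\<bar> \<le> C * decay x"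
    and even: "\<And>x. g (- x) = g x"
    and neg: "\<And>k. k \<noteq> (\<lambda>_. 0) \<Longrightarrow> (LINT y|lborel. g y * cos (2 * pi * (of_int_vec k \<bullet> y))) \<le> 0"
    and ge: "(LINT y|lborel. g y) \<le> (\<Sum>\<^sub>\<infinity>m. g (of_int_vec m))"
  shows "(\<Sum>\<^sub>\<infinity>m. g (of_int_vec m)) = (LINT y|lborel. g y)"
    and "\<And>s. (\<And>i. \<bar>s $ i\<bar> \<le> 1/2) \<Longrightarrow> (\<Sum>\<^sub>\<infinity>m. g (of_int_vec m + s)) = (LINT y|lborel. g y)"
proof -
  have [measurable]: "g \<in> borel_measurable borel"
    using cont by (rule borel_measurable_continuous_onI)
  have int: "integrable lborel f"
    if "\<And>x. \<bar>f x\<bar> \<le> K * decay x" "f \<in> borel_measurable borel" for f :: "real ^ 'n \<Rightarrow> real" and K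
  proof (rule Bochner_Integration.integrable_bound)
    show "integrable lborel (\<lambda>x::real^'n. K * decay x)"
      by (intro integrable_mult_right integrable_decay)
    show "AE x in lborel. norm (f x) \<le> norm (K * decay x)"
      unfolding real_norm_def by (intro AE_I2 order_trans[OF that(1) abs_ge_self])
  qed (use that in simp)
  have g_int: "integrable lborel g"
    by (rule int[OF bound]) measurable
  have cos_int: "integrable lborel (\<lambda>y. g y * cos (p y))"
    and sin_int: "integrable lborel (\<lambda>y. g y * sin (p y))"
    if [measurable]: "p \<in> borel_measurable borel" for p
    by (rule Bochner_Integration.integrable_bound[OF g_int]; auto simp: abs_mult mult_left_le)+
  define G where "G k = (LINT y|lborel. g y * cos (2 * pi * (of_int_vec k \<bullet> y)))" for k
  have G0: "G (\<lambda>_. 0) = (LINT y|lborel. g y)"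
  proof -
    have "of_int_vec (\<lambda>_. 0) = (0 :: real ^ 'n)"
      by (simp add: vec_eq_iff)
    then show ?thesis
      by (simp add: G_def)
  qed
  have neg': "G k \<le> 0" if "k \<noteq> (\<lambda>_. 0)" for k
    unfolding G_def using that by (rule neg)
  \<comment> \<open>\<open>S\<close> and \<open>T s\<close> are the Fejer averages at the shifts 0
    and \<open>s\<close> without the diagonal \<open>b = a\<close>, which for \<open>N > 0\<close>
    contributes exactly \<open>G (\<lambda>_. 0)\<close>.\<close>
  define S where "S N = (\<Sum>a\<in>fejer_index N. \<Sum>b\<in>fejer_index N.
      if b = a then 0 else G (\<lambda>i. a i - b i)) / real N ^ CARD('n)" for N
  define T where "T s N = (\<Sum>a\<in>fejer_index N. \<Sum>b\<in>fejer_index N.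
      if b = a then 0 else G (\<lambda>i. a i - b i) * cos (2 * pi * (of_int_vec (\<lambda>i. a i - b i) \<bullet> s)))
      / real N ^ CARD('n)" for s N
  have T_le: "\<bar>T s N\<bar> \<le> - S N" for s N
  proof -
    have "\<bar>if b = a then 0 else G (\<lambda>i. a i - b i) * cos (2 * pi * (of_int_vec (\<lambda>i. a i - b i) \<bullet> s))\<bar>
        \<le> - (if b = a then 0 else G (\<lambda>i. a i - b i))" for a b
    proof (cases "b = a")
      case False
      then have "(\<lambda>i. a i - b i) \<noteq> (\<lambda>_. 0)"
        by (metis ext right_minus_eq)
      then show ?thesis
        using neg'[of "\<lambda>i. a i - b i"] False
          mult_left_le[of "\<bar>cos (2 * pi * (of_int_vec (\<lambda>i. a i - b i) \<bullet> s))\<bar>" "- G (\<lambda>i. a i - b i)"]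
        by (simp add: abs_mult)
    qed simp
    then have "\<bar>\<Sum>a\<in>fejer_index N. \<Sum>b\<in>fejer_index N.
        if b = a then 0 else G (\<lambda>i. a i - b i) * cos (2 * pi * (of_int_vec (\<lambda>i. a i - b i) \<bullet> s))\<bar>
      \<le> (\<Sum>a\<in>fejer_index N. \<Sum>b\<in>fejer_index N. - (if b = a then 0 else G (\<lambda>i. a i - b i)))"
      by (intro order_trans[OF sum_abs] sum_mono)
    then have "\<bar>T s N\<bar> \<le> (\<Sum>a\<in>fejer_index N. \<Sum>b\<in>fejer_index N.
        - (if b = a then 0 else G (\<lambda>i. a i - b i))) / real N ^ CARD('n)"
      unfolding T_def abs_divide by (simp add: divide_right_mono)
    then show ?thesis
      by (simp only: S_def sum_negf minus_divide_left)
  qed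
  have T0: "T 0 = S"
    by (rule ext) (simp add: T_def S_def cong: if_cong)
  \<comment> \<open>The addition formula yields a cosine and a sine integral; the latter vanishes
    because \<open>g\<close> is even.\<close>
  have shift: "(LINT y|lborel. g (y + s) * cos (2 * pi * (of_int_vec k \<bullet> y)))
      = G k * cos (2 * pi * (of_int_vec k \<bullet> s))" for k s
  proof -
    let ?p = "\<lambda>y. 2 * pi * (of_int_vec k \<bullet> y)"
    have "(LINT y|lborel. g y * sin (?p y)) = (LINT y|lborel. g (- y) * sin (?p (- y)))"
      by (rule lborel_integral_uminus[symmetric]) measurable
    then have sin0: "(LINT y|lborel. g y * sin (?p y)) = 0"
      by (simp add: even)
    have "(LINT y|lborel. g (y + s) * cos (?p y)) = (LINT y|lborel. g (y + s) * cos (?p (y + s - s)))"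
      by simp
    also have "\<dots> = (LINT y|lborel. g y * cos (?p (y - s)))"
      by (rule lborel_integral_translation[of "\<lambda>y. g y * cos (?p (y - s))"]) measurable
    also have "\<dots> = (LINT y|lborel. cos (?p s) * (g y * cos (?p y)) + sin (?p s) * (g y * sin (?p y)))"
      by (intro Bochner_Integration.integral_cong)
         (auto simp: inner_diff_right right_diff_distrib cos_diff algebra_simps)
    also have "\<dots> = cos (?p s) * G k"
      by (subst Bochner_Integration.integral_add)
         (auto simp: sin0 G_def intro!: integrable_mult_right cos_int sin_int)
    finally show ?thesis
      by simp
  qed
  have lim: "(\<lambda>N. G (\<lambda>_. 0) + T s N) \<longlonglongrightarrow> (\<Sum>\<^sub>\<infinity>m. g (of_int_vec m + s))"
    if s: "\<And>i. \<bar>s $ i\<bar> \<le> 1/2" for s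
  proof -
    have C: "C \<ge> 0"
    proof -
      have "0 \<le> \<bar>g 0\<bar>" by simp
      also have "\<dots> \<le> C * decay (0 :: real ^ 'n)" by (rule bound)
      finally show ?thesis
        using decay_pos[of "0 :: real^'n"] by (simp add: zero_le_mult_iff)
    qed
    have bound': "\<bar>g (x + s)\<bar> \<le> C * 4 ^ CARD('n) * decay x" for x
    proof -
      have "C * decay (x + s) \<le> C * (4 ^ CARD('n) * decay x)"
        using C s by (intro mult_left_mono decay_add_le)
      then show ?thesis
        using bound[of "x + s"] by (simp add: mult_ac)
    qed
    have "continuous_on UNIV (\<lambda>y. g (y + s))"
      by (intro continuous_on_compose2[OF cont] continuous_intros) auto
    then have lim: "(\<lambda>N. LINT y|lborel. g (y + s) * fejer N y) \<longlonglongrightarrow> (\<Sum>\<^sub>\<infinity>m. g (of_int_vec m + s))"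
      using bound' by (rule fejer_poisson)
    have int': "integrable lborel (\<lambda>y. g (y + s) * cos (2 * pi * (of_int_vec k \<bullet> y)))" for k
    proof (rule Bochner_Integration.integrable_bound)
      show "integrable lborel (\<lambda>y. g (y + s))"
        by (rule int[OF bound']) measurable
    qed (auto simp: abs_mult mult_left_le)
    have "(LINT y|lborel. g (y + s) * fejer N y) = G (\<lambda>_. 0) + T s N" if N: "N > 0" for N
    proof -
      let ?F = "\<lambda>a b. G (\<lambda>i. a i - b i) * cos (2 * pi * (of_int_vec (\<lambda>i. a i - b i) \<bullet> s))"
      have "?F a b = (if b = a then G (\<lambda>_. 0) else 0) + (if b = a then 0 else ?F a b)" for a b
      proof -
        have "of_int_vec (\<lambda>_. 0) = (0 :: real ^ 'n)"
          by (simp add: vec_eq_iff)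
        then show ?thesis
          by simp
      qed
      then have "(\<Sum>a\<in>fejer_index N. \<Sum>b\<in>fejer_index N. ?F a b)
          = (\<Sum>a\<in>fejer_index N. \<Sum>b\<in>fejer_index N.
              (if b = a then G (\<lambda>_. 0) else 0) + (if b = a then 0 else ?F a b))"
        by (intro sum.cong refl)
      also have "\<dots> = real N ^ CARD('n) * G (\<lambda>_. 0)
          + (\<Sum>a\<in>fejer_index N. \<Sum>b\<in>fejer_index N. if b = a then 0 else ?F a b)"
        by (simp add: sum.distrib card_fejer_index)
      finally show ?thesis
        using N by (simp add: integral_mult_fejer[OF int'] shift T_def add_divide_distrib)
    qed
    then have "\<forall>\<^sub>F N in sequentially. (LINT y|lborel. g (y + s) * fejer N y) = G (\<lambda>_. 0) + T s N"
      by (rule eventually_mono[OF eventually_gt_at_top[of 0]])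
    then show ?thesis
      by (rule tendsto_cong[THEN iffD1, OF _ lim])
  qed
  have lim0: "(\<lambda>N. G (\<lambda>_. 0) + S N) \<longlonglongrightarrow> (\<Sum>\<^sub>\<infinity>m. g (of_int_vec m))"
    using lim[of 0] by (simp add: T0)
  have "S N \<le> 0" for N
    using T_le[of 0 N] by simp
  then have "(\<Sum>\<^sub>\<infinity>m. g (of_int_vec m)) \<le> G (\<lambda>_. 0)"
    by (intro LIMSEQ_le_const2[OF lim0]) simp
  then show eq: "(\<Sum>\<^sub>\<infinity>m. g (of_int_vec m)) = (LINT y|lborel. g y)"
    using ge by (simp add: G0)
  then have "(\<lambda>N. G (\<lambda>_. 0) + S N - G (\<lambda>_. 0)) \<longlonglongrightarrow> 0"
    using tendsto_diff[OF lim0 tendsto_const[of "G (\<lambda>_. 0)"]] by (simp add: G0)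
  then have S_lim: "(\<lambda>N. - S N) \<longlonglongrightarrow> 0"
    using tendsto_minus by fastforce
  fix s :: "real ^ 'n" assume s: "\<And>i. \<bar>s $ i\<bar> \<le> 1/2"
  have "T s \<longlonglongrightarrow> 0"
    using T_le by (intro Lim_null_comparison[OF _ S_lim] always_eventually) simp
  then have "(\<lambda>N. G (\<lambda>_. 0) + T s N) \<longlonglongrightarrow> G (\<lambda>_. 0)"
    by (intro tendsto_eq_intros) auto
  then show "(\<Sum>\<^sub>\<infinity>m. g (of_int_vec m + s)) = (LINT y|lborel. g y)"
    using LIMSEQ_unique[OF lim[OF s]] G0 by simp
qed

section \<open>Schwartz functions: continuity, decay and the cosine transform\<close>

lemma schwartz_continuous:
  assumes "schwartz h"
  shows "continuous_on UNIV h"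
proof -
  have "h differentiable (at x)" for x
    using assms unfolding schwartz_def by (metis iter_partial_deriv.simps(1))
  then show ?thesis
    by (meson continuous_at_imp_continuous_on differentiable_imp_continuous_within)
qed

text \<open>The bound is stated for any \<open>y\<close> of the same norm so that it survives composition with
  orthogonal maps, which do not preserve \<open>decay\<close>.\<close>
lemma schwartz_decay:
  fixes h :: "real ^ 'n \<Rightarrow> real"
  assumes "schwartz h"
  obtains C where "\<And>x y :: real ^ 'n. norm x = norm y \<Longrightarrow> \<bar>h x\<bar> \<le> C * decay y"
proof -
  have "bounded (range (\<lambda>x. norm x ^ k * h x))" for k
    using assms unfolding schwartz_def by (metis iter_partial_deriv.simps(1))
  then have "\<exists>B. \<forall>x. \<bar>norm x ^ k * h x\<bar> \<le> B" for k
    unfolding bounded_iff by auto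
  then obtain B where B: "\<And>k x. \<bar>norm x ^ k * h x\<bar> \<le> B k"
    by metis
  define n where "n = CARD('n)"
  \<comment> \<open>Two moments suffice: the reciprocal of \<open>decay y\<close> is at most
    \<open>(1 + (norm x)\<^sup>2) ^ n\<close>, and this is at most
    \<open>2 ^ n * (1 + norm x ^ (2 * n))\<close>.\<close>
  have "\<bar>h x\<bar> \<le> 2 ^ n * (B 0 + B (2 * n)) * decay y" if "norm x = norm y" for x y :: "real ^ 'n"
  proof -
    have "(y $ i)\<^sup>2 \<le> (norm y)\<^sup>2" for i
      using power_mono[OF component_le_norm_cart[of y i], of 2] by simp
    then have "(\<Prod>i\<in>UNIV. 1 + (y $ i)\<^sup>2) \<le> (\<Prod>i\<in>(UNIV :: 'n set). 1 + (norm y)\<^sup>2)"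
      by (intro prod_mono) simp
    also have "\<dots> = (1 + (norm x)\<^sup>2) ^ n"
      by (simp add: n_def that)
    also have "\<dots> \<le> (2 * max 1 ((norm x)\<^sup>2)) ^ n"
      by (intro power_mono) auto
    also have "\<dots> \<le> 2 ^ n * (1 + norm x ^ (2 * n))"
      by (auto simp: power_mult_distrib max_def power_mult)
    finally have le: "(\<Prod>i\<in>UNIV. 1 + (y $ i)\<^sup>2) \<le> 2 ^ n * (1 + norm x ^ (2 * n))" .
    have "\<bar>h x\<bar> * (\<Prod>i\<in>UNIV. 1 + (y $ i)\<^sup>2) \<le> \<bar>h x\<bar> * (2 ^ n * (1 + norm x ^ (2 * n)))"
      using le by (rule mult_left_mono) simp
    also have "\<dots> = 2 ^ n * (\<bar>norm x ^ 0 * h x\<bar> + \<bar>norm x ^ (2 * n) * h x\<bar>)"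
      by (simp add: abs_mult algebra_simps)
    also have "\<dots> \<le> 2 ^ n * (B 0 + B (2 * n))"
      by (intro mult_left_mono add_mono B) simp
    finally have "\<bar>h x\<bar> * (\<Prod>i\<in>UNIV. 1 + (y $ i)\<^sup>2) \<le> 2 ^ n * (B 0 + B (2 * n))" .
    moreover have "(\<Prod>i\<in>UNIV. 1 + (y $ i)\<^sup>2) > 0"
      by (intro prod_pos) (simp add: add_pos_nonneg)
    ultimately show ?thesis
      by (simp add: decay_def prod_dividef pos_le_divide_eq)
  qed
  then show ?thesis
    by (rule that)
qed

lemma real_fourier_eq:
  fixes h :: "real ^ 'n \<Rightarrow> real"
  assumes h: "integrable lborel h"
  shows "real_fourier h \<xi> = (LINT x|lborel. h x * cos (2 * pi * (\<xi> \<bullet> x)))"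
proof -
  let ?g = "\<lambda>x. of_real (h x) * exp (- 2 * of_real pi * \<i> * of_real (x \<bullet> \<xi>)) :: complex"
  have [measurable]: "h \<in> borel_measurable borel"
    using h by (auto dest: borel_measurable_integrable)
  have "integrable lborel ?g"
    by (rule Bochner_Integration.integrable_bound[OF h]) (auto simp: norm_mult)
  then have "(LINT x|lborel. Re (?g x)) = Re (integral\<^sup>L lborel ?g)"
    by (rule integral_Re)
  moreover have "Re (?g x) = h x * cos (2 * pi * (\<xi> \<bullet> x))" for x
    by (simp add: Re_exp inner_commute)
  ultimately show ?thesis
    by (simp only: real_fourier_def fourier_def)
qed

section \<open>Rotated integer lattices\<close>

lemma orthogonal_image_lattice:
  fixes R :: "real ^ 'n \<Rightarrow> real ^ 'n"
  assumes R: "orthogonal_transformation R"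
  obtains L where "unimodular_lattice L" "integral_lattice L" "\<And>m. R (of_int_vec m) \<in> L"
proof
  define A where "A = matrix R"
  have A: "orthogonal_matrix A" and R_A: "R = (*v) A"
    using R by (auto simp: A_def orthogonal_transformation_matrix matrix_works fun_eq_iff)
  have det: "\<bar>det A\<bar> = 1"
    using det_orthogonal_matrix[OF A] by auto
  then have inv: "invertible A"
    by (auto simp: invertible_det_nz)
  have L: "is_lattice (lattice_of A)"
    using inv by (auto simp: is_lattice_def)
  show "unimodular_lattice (lattice_of A)"
    using L det by (simp add: unimodular_lattice_def covol_lattice_of[OF inv])
  have "(A *v x) \<bullet> (A *v y) = x \<bullet> y" for x y
    using R unfolding R_A orthogonal_transformation_def by blast
  then show "integral_lattice (lattice_of A)"
    using L int_vectors_unimodular_integral(2) by (auto simp: integral_lattice_def lattice_of_def)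
  show "R (of_int_vec m) \<in> lattice_of A" for m
    by (simp add: lattice_of_def R_A)
qed

lemma orthogonal_reflection:
  fixes r :: "'a::real_inner"
  assumes "r \<bullet> r = 1"
  shows "orthogonal_transformation (\<lambda>y. y - (2 * (r \<bullet> y)) *\<^sub>R r)"
  unfolding orthogonal_transformation_def
proof (intro conjI allI)
  show "linear (\<lambda>y. y - (2 * (r \<bullet> y)) *\<^sub>R r)"
    by (rule linearI) (simp_all add: inner_add_right algebra_simps)
  show "(v - (2 * (r \<bullet> v)) *\<^sub>R r) \<bullet> (w - (2 * (r \<bullet> w)) *\<^sub>R r) = v \<bullet> w" for v w
    by (simp add: inner_diff_left inner_diff_right assms inner_commute[of v r])
qed

text \<open>The reflection is in one of the two roots \<open>(1/2, 1/2, 1/2, 1/2)\<close> and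
  \<open>(- 1/2, 1/2, 1/2, 1/2)\<close>, whichever makes \<open>2 * (r \<bullet> x)\<close> odd.\<close>
lemma half_integer_block_reflection:
  fixes x :: "real ^ 'n"
  assumes B: "card B = 4" and half: "\<And>i. i \<in> B \<Longrightarrow> x $ i - 1/2 \<in> \<int>"
  obtains R where "orthogonal_transformation R" "\<And>i. i \<in> B \<Longrightarrow> R x $ i \<in> \<int>"
    "\<And>i. i \<notin> B \<Longrightarrow> R x $ i = x $ i"
proof -
  obtain i0 where i0: "i0 \<in> B"
    using B by fastforce
  have "\<forall>i\<in>B. \<exists>k. x $ i = of_int k + 1/2"
  proof
    fix i assume "i \<in> B"
    then obtain k where "x $ i - 1/2 = of_int k"
      using half by (auto elim: Ints_cases)
    then show "\<exists>k. x $ i = of_int k + 1/2"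
      by (intro exI[of _ k]) simp
  qed
  then have "\<exists>m. \<forall>i\<in>B. x $ i = of_int (m i) + 1/2"
    by (rule bchoice)
  then obtain m where m: "\<And>i. i \<in> B \<Longrightarrow> x $ i = of_int (m i) + 1/2"
    by blast
  \<comment> \<open>The four halves in the block add up to 2, so \<open>p\<close> is the sum of the
    entries of \<open>x\<close> over \<open>B\<close>. Flipping the sign at \<open>i0\<close>
    subtracts \<open>2 * x $ i0 = 2 * m i0 + 1\<close>, an odd number, and so changes the parity;
    \<open>q\<close> is the odd one of the two values.\<close>
  define p where "p = (\<Sum>i\<in>B. m i) + 2"
  define \<epsilon> :: int where "\<epsilon> = (if odd p then 1 else - 1)"
  define q where "q = (if odd p then p else p - 2 * m i0 - 1)"
  have "odd q"
    by (simp add: q_def)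
  then obtain q' where q': "q = 2 * q' + 1"
    by (elim oddE)
  define r :: "real ^ 'n"
    where "r = (\<chi> i. if i \<in> B then (if i = i0 then of_int \<epsilon> / 2 else 1/2) else 0)"
  have sum_x: "(\<Sum>i\<in>B. x $ i) = of_int p"
    using B by (simp add: m p_def sum.distrib)
  have "r \<bullet> y = (\<Sum>i\<in>B. r $ i * y $ i)" for y
    unfolding inner_vec_def inner_real_def by (rule sum.mono_neutral_right) (auto simp: r_def)
  then have inner_r: "r \<bullet> y = (of_int \<epsilon> * y $ i0 + (\<Sum>i\<in>B - {i0}. y $ i)) / 2" for y
    using i0 by (simp add: sum.remove[of B i0] r_def sum_divide_distrib add_divide_distrib)
  have "(\<Sum>i\<in>B - {i0}. r $ i) = (\<Sum>i\<in>B - {i0}. 1/2)"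
    by (intro sum.cong) (auto simp: r_def)
  also have "\<dots> = 3/2"
    using B i0 by simp
  finally have "r \<bullet> r = 1"
    using i0 by (simp add: inner_r) (simp add: r_def \<epsilon>_def)
  then have R: "orthogonal_transformation (\<lambda>y. y - (2 * (r \<bullet> y)) *\<^sub>R r)"
    by (rule orthogonal_reflection)
  have q: "2 * (r \<bullet> x) = of_int q"
    using sum_x i0 m[OF i0] by (simp add: inner_r q_def \<epsilon>_def sum.remove[of B i0])
  show ?thesis
  proof (rule that[OF R])
    show "(x - (2 * (r \<bullet> x)) *\<^sub>R r) $ i = x $ i" if "i \<notin> B" for i
      using that by (simp add: r_def)
    fix i assume i: "i \<in> B"
    \<comment> \<open>The reflection subtracts \<open>q\<close> times 1/2 or -1/2 from a
      half-integer. As \<open>q\<close> is odd, the result is an integer.\<close>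
    have "(x - (2 * (r \<bullet> x)) *\<^sub>R r) $ i = of_int (m i - q')
        \<or> (x - (2 * (r \<bullet> x)) *\<^sub>R r) $ i = of_int (m i + q' + 1)"
      using i unfolding q by (auto simp: r_def m q' \<epsilon>_def field_simps)
    then show "(x - (2 * (r \<bullet> x)) *\<^sub>R r) $ i \<in> \<int>"
      by (metis Ints_of_int)
  qed
qed

definition half_vec :: "'n set \<Rightarrow> real ^ 'n" where
  "half_vec B = (\<chi> i. if i \<in> B then 1/2 else 0)"

text \<open>One reflection per block: the second changes only the coordinates in \<open>B'\<close>,
  so it does not disturb the integers already produced on \<open>B\<close>. The inverse of the
  composite is the required map. Allowing \<open>B'\<close> to be empty treats both shifts
  together.\<close>

lemma half_vec_orthogonal_image:
  fixes B B' :: "'n::finite set"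
  assumes B: "card B = 4" and B': "B' = {} \<or> card B' = 4" and disj: "B \<inter> B' = {}"
  obtains R k where "orthogonal_transformation R"
    "of_int_vec m + half_vec (B \<union> B') = R (of_int_vec k :: real ^ 'n)"
proof -
  define x where "x = of_int_vec m + half_vec (B \<union> B')"
  obtain R where R: "orthogonal_transformation R" "\<And>i. i \<in> B \<Longrightarrow> R x $ i \<in> \<int>"
    "\<And>i. i \<notin> B \<Longrightarrow> R x $ i = x $ i"
    by (rule half_integer_block_reflection[OF B, of x]) (auto simp: x_def half_vec_def)
  have "\<exists>R' :: real ^ 'n \<Rightarrow> real ^ 'n. orthogonal_transformation R' \<and> R' x \<in> int_vectors"
  proof (cases "B' = {}")
    case True
    then have "R x $ i \<in> \<int>" for i
      using R by (cases "i \<in> B") (auto simp: x_def half_vec_def)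
    then show ?thesis
      using R(1) by (intro exI[of _ R]) (simp add: int_vectors_def)
  next
    case False
    then have card: "card B' = 4" using B' by simp
    have "R x $ i - 1/2 \<in> \<int>" if "i \<in> B'" for i
    proof -
      have "i \<notin> B" using disj that by auto
      then show ?thesis
        using R(3)[of i] that by (simp add: x_def half_vec_def)
    qed
    then obtain S where S: "orthogonal_transformation S" "\<And>i. i \<in> B' \<Longrightarrow> S (R x) $ i \<in> \<int>"
      "\<And>i. i \<notin> B' \<Longrightarrow> S (R x) $ i = R x $ i"
      using half_integer_block_reflection[OF card, of "R x"] by metis
    have "S (R x) $ i \<in> \<int>" for i
    proof (cases "i \<in> B \<union> B'")
      case True
      then show ?thesis
        using R(2)[of i] S(2,3)[of i] by (cases "i \<in> B'") auto
    next
      case False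
      then show ?thesis
        using R(3)[of i] S(3)[of i] by (simp add: x_def half_vec_def)
    qed
    then show ?thesis
      using orthogonal_transformation_compose[OF S(1) R(1)] by (auto simp: int_vectors_def o_def)
  qed
  then obtain R' :: "real ^ 'n \<Rightarrow> real ^ 'n" where R': "orthogonal_transformation R'" "R' x \<in> int_vectors"
    by blast
  moreover obtain k where "R' x = of_int_vec k"
    using R'(2) bij_betw_imp_surj_on[OF bij_betw_of_int_vec] by blast
  moreover have "x = inv R' (R' x)"
    using orthogonal_transformation_inj[OF R'(1)] by simp
  ultimately show ?thesis
    using that[OF orthogonal_transformation_inv[OF R'(1)]] by (simp add: x_def)
qed

section \<open>Theta sums\<close>

definition theta :: "real \<Rightarrow> real \<Rightarrow> real" where
  "theta t c = (\<Sum>\<^sub>\<infinity>j::int. exp (- t * (of_int j + c)\<^sup>2))"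

lemma summable_on_theta:
  fixes t c :: real
  assumes t: "t > 0"
  shows "(\<lambda>j::int. exp (- t * (of_int j + c)\<^sup>2)) summable_on UNIV"
proof -
  \<comment> \<open>The factor \<open>2 + 2 * c\<^sup>2\<close> compares
    \<open>1 + j\<^sup>2\<close> with \<open>1 + (j + c)\<^sup>2\<close>; the factor
    \<open>max 1 (1 / t)\<close> comes from \<open>1 + u \<le> exp u\<close> at
    \<open>u = t * (j + c)\<^sup>2\<close>.\<close>
  define K where "K = max 1 (1 / t) * (2 + 2 * c\<^sup>2)"
  have "exp (- t * (of_int j + c)\<^sup>2) \<le> K * (1 / (1 + (of_int j)\<^sup>2))" for j :: int
  proof -
    define x where "x = of_int j + c"
    have "(of_int j)\<^sup>2 \<le> 2 * x\<^sup>2 + 2 * c\<^sup>2"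
      using zero_le_power2[of "x + c"] by (simp add: x_def power2_eq_square algebra_simps)
    moreover have "0 \<le> c\<^sup>2 * x\<^sup>2"
      by simp
    ultimately have "1 + (of_int j)\<^sup>2 \<le> (2 + 2 * c\<^sup>2) * (1 + x\<^sup>2)"
      using zero_le_power2[of x] zero_le_power2[of c] unfolding distrib_left distrib_right by argo
    also have "\<dots> \<le> (2 + 2 * c\<^sup>2) * (max 1 (1 / t) * exp (t * x\<^sup>2))"
    proof (rule mult_left_mono)
      have "x\<^sup>2 = (1 / t) * (t * x\<^sup>2)"
        using t by simp
      also have "\<dots> \<le> max 1 (1 / t) * (t * x\<^sup>2)"
        using t by (intro mult_right_mono) auto
      finally have "1 + x\<^sup>2 \<le> max 1 (1 / t) * (1 + t * x\<^sup>2)"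
        by (simp add: distrib_left)
      also have "\<dots> \<le> max 1 (1 / t) * exp (t * x\<^sup>2)"
        by (intro mult_left_mono exp_ge_add_one_self) simp
      finally show "1 + x\<^sup>2 \<le> max 1 (1 / t) * exp (t * x\<^sup>2)" .
    qed simp
    finally have "1 + (of_int j)\<^sup>2 \<le> K * exp (t * x\<^sup>2)"
      by (simp add: K_def mult_ac)
    then show ?thesis
      by (simp add: x_def exp_minus divide_simps add_pos_nonneg)
  qed
  then show ?thesis
    by (intro summable_on_comparison_test[OF summable_on_cmult_right[OF summable_on_inverse_square_int]]) auto
qed

lemma exp_le_theta:
  assumes "t > 0"
  shows "exp (- t * c\<^sup>2) \<le> theta t c"
  using finite_sum_le_infsum[OF summable_on_theta[OF assms, of c], of "{0}"] by (simp add: theta_def)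

lemma
  fixes s :: "real ^ 'n"
  assumes "t > 0"
  shows summable_on_gaussian: "(\<lambda>m. exp (- t * (norm (of_int_vec m + s))\<^sup>2)) summable_on UNIV"
    and infsum_gaussian:
      "(\<Sum>\<^sub>\<infinity>m. exp (- t * (norm (of_int_vec m + s))\<^sup>2)) = (\<Prod>i\<in>UNIV. theta t (s $ i))"
proof -
  have eq: "exp (- t * (norm (of_int_vec m + s))\<^sup>2) = (\<Prod>i\<in>UNIV. exp (- t * (of_int (m i) + s $ i)\<^sup>2))" for m
  proof -
    have "(norm (of_int_vec m + s))\<^sup>2 = (\<Sum>i\<in>UNIV. (of_int (m i) + s $ i)\<^sup>2)"
      unfolding power2_norm_eq_inner inner_vec_def by (simp add: power2_eq_square)
    then show ?thesis
      by (simp add: sum_distrib_left exp_sum flip: sum_negf)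
  qed
  show "(\<lambda>m. exp (- t * (norm (of_int_vec m + s))\<^sup>2)) summable_on UNIV"
    unfolding eq by (rule summable_on_prod_int) (rule summable_on_theta[OF assms])
  show "(\<Sum>\<^sub>\<infinity>m. exp (- t * (norm (of_int_vec m + s))\<^sup>2)) = (\<Prod>i\<in>UNIV. theta t (s $ i))"
    unfolding eq theta_def by (rule infsum_prod_int) (rule summable_on_theta[OF assms])
qed

lemma infsum_gaussian_half_vec:
  fixes B :: "'n::finite set"
  assumes "t > 0"
  shows "(\<Sum>\<^sub>\<infinity>m. exp (- t * (norm (of_int_vec m + half_vec B))\<^sup>2))
    = theta t (1/2) ^ card B * theta t 0 ^ (CARD('n) - card B)"
proof -
  have "(\<Prod>i\<in>UNIV. theta t (half_vec B $ i)) = (\<Prod>i\<in>B. theta t (1/2)) * (\<Prod>i\<in>- B. theta t 0)"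
    unfolding half_vec_def vec_lambda_beta
    by (simp add: if_distrib[of "theta t"] prod.If_cases)
  moreover have "card (- B) = CARD('n) - card B"
    by (simp add: Compl_eq_Diff_UNIV card_Diff_subset)
  ultimately show ?thesis
    using infsum_gaussian[OF assms, of "half_vec B"] by simp
qed

section \<open>Duplication formulas for the theta sums\<close>

lemma theta_shift: "theta t (c + 1) = theta t c"
proof -
  have "bij (\<lambda>j::int. j + 1)"
    by (rule bij_betw_byWitness[where f' = "\<lambda>j. j - 1"]) auto
  from infsum_reindex_bij_betw[OF this, of "\<lambda>j. exp (- t * (of_int j + c)\<^sup>2)"]
  show ?thesis
    by (simp add: theta_def add_ac)
qed

lemma
  fixes f g :: "'a \<Rightarrow> real"
  assumes f: "f summable_on UNIV" "\<And>x. f x \<ge> 0" and g: "g summable_on UNIV" "\<And>x. g x \<ge> 0"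
  shows summable_on_product: "(\<lambda>(x, y). f x * g y) summable_on UNIV"
    and infsum_product: "(\<Sum>\<^sub>\<infinity>(x, y). f x * g y) = infsum f UNIV * infsum g UNIV"
proof -
  have inner: "((\<lambda>y. case (x, y) of (x, y) \<Rightarrow> f x * g y) has_sum f x * infsum g UNIV) UNIV" for x
    using has_sum_cmult_right[OF has_sum_infsum[OF g(1)]] by simp
  have outer: "((\<lambda>x. f x * infsum g UNIV) has_sum infsum f UNIV * infsum g UNIV) UNIV"
    using has_sum_cmult_left[OF has_sum_infsum[OF f(1)]] by simp
  have "(\<lambda>(x, y). f x * g y) summable_on UNIV \<times> UNIV"
    by (rule summable_on_SigmaI[OF inner]) (use outer f g in \<open>auto dest: has_sum_imp_summable\<close>)
  then show sum: "(\<lambda>(x, y). f x * g y) summable_on UNIV"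
    by simp
  have "((\<lambda>(x, y). f x * g y) has_sum infsum f UNIV * infsum g UNIV) (UNIV \<times> UNIV)"
    by (rule has_sum_SigmaI[OF inner outer]) (use sum in simp)
  then show "(\<Sum>\<^sub>\<infinity>(x, y). f x * g y) = infsum f UNIV * infsum g UNIV"
    by (simp add: infsumI)
qed

text \<open>The pairs are sorted by the parity of their sum. The coordinates \<open>u\<close>,
  \<open>v\<close> are chosen because \<open>(u + v)\<^sup>2 + (u - v)\<^sup>2 = 2 * (u\<^sup>2 +
  v\<^sup>2)\<close>, which turns a product of Gaussians at \<open>t\<close> into one at
  \<open>2 * t\<close>.\<close>

lemma infsum_int_pairs_split:
  fixes F :: "int \<times> int \<Rightarrow> real"
  assumes F: "F summable_on UNIV"
  shows "infsum F UNIV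
    = (\<Sum>\<^sub>\<infinity>(u, v). F (u + v, u - v)) + (\<Sum>\<^sub>\<infinity>(u, v). F (u + v + 1, u - v))"
proof -
  let ?E = "{(a, b). even (a + b :: int)}" and ?O = "{(a, b). odd (a + b :: int)}"
  have E: "bij_betw (\<lambda>(u, v). (u + v, u - v)) UNIV ?E"
    by (rule bij_betw_byWitness[where f' = "\<lambda>(a, b). ((a + b) div 2, (a - b) div 2)"])
       (auto, presburger+)
  have O: "bij_betw (\<lambda>(u, v). (u + v + 1, u - v)) UNIV ?O"
    by (rule bij_betw_byWitness[where f' = "\<lambda>(a, b). ((a + b - 1) div 2, (a - b - 1) div 2)"])
       (auto, presburger+)
  have "infsum F (?E \<union> ?O) = infsum F ?E + infsum F ?O"
    by (intro infsum_Un_disjoint summable_on_subset[OF F]) auto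
  moreover have "?E \<union> ?O = UNIV"
    by auto
  ultimately show ?thesis
    using infsum_reindex_bij_betw[OF E, of F] infsum_reindex_bij_betw[OF O, of F]
    by (simp add: case_prod_unfold)
qed

lemma theta_mult:
  assumes "t > 0"
  shows "(\<Sum>\<^sub>\<infinity>(u, v). exp (- t * (of_int u + c)\<^sup>2) * exp (- t * (of_int v + d)\<^sup>2)) = theta t c * theta t d"
  unfolding theta_def by (rule infsum_product) (simp_all only: summable_on_theta[OF assms] exp_ge_zero)

text \<open>These are the classical identities expressing the squares of the Jacobi constants
  theta_3 and theta_2 at \<open>q\<close> through their values at \<open>q\<^sup>2\<close>, with
  \<open>q = exp (- t)\<close>.\<close>

lemma
  assumes t: "t > 0"
  shows theta_0_squared: "(theta t 0)\<^sup>2 = (theta (2 * t) 0)\<^sup>2 + (theta (2 * t) (1/2))\<^sup>2"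
    and theta_half_squared: "(theta t (1/2))\<^sup>2 = 2 * theta (2 * t) 0 * theta (2 * t) (1/2)"
proof -
  have t2: "2 * t > 0" using t by simp
  define F where "F c = (\<lambda>(a::int, b::int). exp (- t * (of_int a + c)\<^sup>2) * exp (- t * (of_int b + c)\<^sup>2))" for c
  have F_sum: "F c summable_on UNIV" for c
    unfolding F_def by (rule summable_on_product) (simp_all only: summable_on_theta[OF t] exp_ge_zero)
  have sq: "(theta t c)\<^sup>2 = infsum (F c) UNIV" for c
    by (simp only: F_def power2_eq_square[of "theta t c"] theta_mult[OF t])
  let ?e = "\<lambda>c d (u::int, v::int). exp (- (2 * t) * (of_int u + c)\<^sup>2) * exp (- (2 * t) * (of_int v + d)\<^sup>2)"
  have E: "F c (u + v, u - v) = ?e c 0 (u, v)" for c u v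
    by (simp add: F_def power2_eq_square algebra_simps flip: exp_add)
  \<comment> \<open>Completing the square for an odd pair puts a half into both coordinates: the sum
    of squares is \<open>2 * ((u + c + 1/2)\<^sup>2 + (v + 1/2)\<^sup>2)\<close>.\<close>
  have O: "F c (u + v + 1, u - v) = ?e (c + 1/2) (1/2) (u, v)" for c u v
    by (simp add: F_def power2_eq_square algebra_simps flip: exp_add)
  have split: "(theta t c)\<^sup>2 = theta (2 * t) c * theta (2 * t) 0 + theta (2 * t) (c + 1/2) * theta (2 * t) (1/2)" for c
    unfolding sq infsum_int_pairs_split[OF F_sum] E O theta_mult[OF t2, symmetric] by simp
  show "(theta t 0)\<^sup>2 = (theta (2 * t) 0)\<^sup>2 + (theta (2 * t) (1/2))\<^sup>2"
    using split[of 0] by (simp add: power2_eq_square)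
  show "(theta t (1/2))\<^sup>2 = 2 * theta (2 * t) 0 * theta (2 * t) (1/2)"
    using split[of "1/2"] theta_shift[of "2 * t" 0] by simp
qed

text \<open>Every point of the coset of half-integers has square at least 1/4, so raising the
  parameter by \<open>r\<close> gains the factor \<open>exp (- r / 4)\<close> in each term. The sum
  over the integers has no such gain because of its term at 0.\<close>

lemma theta_half_le:
  assumes "t > 0" "r \<ge> 0"
  shows "theta (t + r) (1/2) \<le> exp (- r / 4) * theta t (1/2)"
proof -
  have "exp (- (t + r) * (of_int j + 1/2)\<^sup>2) \<le> exp (- r / 4) * exp (- t * (of_int j + 1/2)\<^sup>2)" for j :: int
  proof -
    have "1/2 \<le> \<bar>of_int j + 1/2 :: real\<bar>"
    proof (cases "j \<ge> 0")
      case False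
      then have "j + 1 \<le> 0" by simp
      then have "of_int (j + 1) \<le> (0 :: real)" by (simp only: of_int_le_0_iff)
      then show ?thesis by simp
    qed simp
    from power_mono[OF this, of 2] have "1/4 \<le> (of_int j + 1/2 :: real)\<^sup>2"
      by (simp add: power_divide)
    then have "r * (1/4) \<le> r * (of_int j + 1/2 :: real)\<^sup>2"
      using assms(2) by (rule mult_left_mono)
    then show ?thesis
      unfolding exp_add[symmetric] by (simp add: algebra_simps)
  qed
  then have "theta (t + r) (1/2) \<le> (\<Sum>\<^sub>\<infinity>j::int. exp (- r / 4) * exp (- t * (of_int j + 1/2)\<^sup>2))"
    unfolding theta_def
    using assms by (intro infsum_mono summable_on_cmult_right summable_on_theta) auto
  also have "\<dots> = exp (- r / 4) * theta t (1/2)"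
    unfolding theta_def by (rule infsum_cmult_right')
  finally show ?thesis .
qed

text \<open>If the two values agreed at \<open>t\<close>, the duplication formulas would make them agree at
  \<open>2 ^ k * t\<close> for all \<open>k\<close>, but one of them tends to 0 and the other does not.\<close>
lemma theta_half_neq_theta_0:
  assumes t: "t > 0"
  shows "theta t (1/2) \<noteq> theta t 0"
proof
  assume eq: "theta t (1/2) = theta t 0"
  have "theta (2 ^ k * t) (1/2) = theta (2 ^ k * t) 0" for k
  proof (induction k)
    case (Suc k)
    let ?t = "2 ^ k * t"
    have "?t > 0" using t by simp
    \<comment> \<open>Equality at \<open>?t\<close> equates the right-hand sides of the two
      formulas, and a sum of squares equal to twice the product means that the difference is
      0.\<close>
    then have "(theta (2 * ?t) 0)\<^sup>2 + (theta (2 * ?t) (1/2))\<^sup>2 = 2 * theta (2 * ?t) 0 * theta (2 * ?t) (1/2)"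
      using theta_0_squared theta_half_squared Suc by metis
    then have "(theta (2 * ?t) (1/2) - theta (2 * ?t) 0)\<^sup>2 = 0"
      by (simp add: power2_eq_square algebra_simps)
    then show ?case
      by (simp add: mult.assoc)
  qed (simp add: eq)
  then have ge: "1 \<le> theta (2 ^ k * t) (1/2)" for k
    using exp_le_theta[of "2 ^ k * t" 0] t by simp
  \<comment> \<open>The increment \<open>(2 ^ k - 1) * t\<close> takes the parameter from
    \<open>t\<close> to \<open>2 ^ k * t\<close>.\<close>
  have "1 \<le> exp (- ((2 ^ k - 1) * t) / 4) * theta t (1/2)" for k
    using theta_half_le[OF t, of "(2 ^ k - 1) * t"] ge[of k] t by (simp add: algebra_simps)
  moreover have "(\<lambda>k. exp (- ((2 ^ k - 1) * t) / 4) * theta t (1/2)) \<longlonglongrightarrow> 0"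
    using t by real_asymp
  ultimately have "(1 :: real) \<le> 0"
    by (intro LIMSEQ_le_const) auto
  then show False by simp
qed

section \<open>Nonexistence\<close>

text \<open>Agreement of \<open>h\<close> with the Gaussian is obtained only at nonzero points, so
  the shifted lattice must avoid the origin.\<close>

lemma half_vec_add_neq_0:
  assumes "i \<in> B"
  shows "of_int_vec m + half_vec B \<noteq> 0"
proof
  assume "of_int_vec m + half_vec B = 0"
  then have "(of_int_vec m + half_vec B) $ i = 0"
    by simp
  then have "of_int (2 * m i + 1) = (0 :: real)"
    using assms by (simp add: half_vec_def)
  then have "2 * m i + 1 = 0"
    by (simp only: of_int_eq_0_iff)
  then show False
    by presburger
qed

theorem corollary1p3:
  fixes t :: real
  assumes "CARD('n::finite) \<ge> 8" and "t > 0"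
  shows "\<not> (\<exists>h :: real ^ 'n \<Rightarrow> real.
    schwartz h \<and> (\<forall>x. h (- x) = h x) \<and>
    (\<forall>L. unimodular_lattice L \<and> integral_lattice L \<longrightarrow>
       (\<forall>x\<in>L. x \<noteq> 0 \<longrightarrow> h x \<ge> exp (- t * (norm x)\<^sup>2))) \<and>
    (\<forall>L. unimodular_lattice L \<and> integral_lattice L \<longrightarrow>
       (\<forall>x\<in>L. x \<noteq> 0 \<longrightarrow> real_fourier h x \<le> 0)) \<and>
    1 + real_fourier h 0 - h 0 = gaussian_mass (int_vectors :: (real ^ 'n) set) t)"
proof (rule notI, elim exE conjE)
  fix h :: "real ^ 'n \<Rightarrow> real"
  assume schwartz: "schwartz h" and even: "\<forall>x. h (- x) = h x"
    and ge_gauss: "\<forall>L. unimodular_lattice L \<and> integral_lattice L \<longrightarrow>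
       (\<forall>x\<in>L. x \<noteq> 0 \<longrightarrow> h x \<ge> exp (- t * (norm x)\<^sup>2))"
    and fourier_le: "\<forall>L. unimodular_lattice L \<and> integral_lattice L \<longrightarrow>
       (\<forall>x\<in>L. x \<noteq> 0 \<longrightarrow> real_fourier h x \<le> 0)"
    and mass: "1 + real_fourier h 0 - h 0 = gaussian_mass (int_vectors :: (real ^ 'n) set) t"
  have t: "t > 0" by fact
  define gauss :: "real ^ 'n \<Rightarrow> real" where "gauss x = exp (- t * (norm x)\<^sup>2)" for x
  have cont: "continuous_on UNIV h"
    using schwartz by (rule schwartz_continuous)
  then have h_meas [measurable]: "h \<in> borel_measurable borel"
    by (rule borel_measurable_continuous_onI)
  obtain C where C: "\<And>x y :: real ^ 'n. norm x = norm y \<Longrightarrow> \<bar>h x\<bar> \<le> C * decay y"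
    using schwartz_decay[OF schwartz] by metis
  have h_int: "integrable lborel h"
  proof (rule Bochner_Integration.integrable_bound)
    show "integrable lborel (\<lambda>x::real^'n. C * decay x)"
      by (intro integrable_mult_right integrable_decay)
    show "AE x in lborel. norm (h x) \<le> norm (C * decay x)"
      unfolding real_norm_def by (intro AE_I2 order_trans[OF C[OF refl] abs_ge_self])
  qed measurable
  define H where "H = real_fourier h 0"
  have H: "H = (LINT x|lborel. h x)"
    unfolding H_def real_fourier_eq[OF h_int] by simp
  have mass': "(\<Sum>\<^sub>\<infinity>m. gauss (of_int_vec m)) = H + 1 - h 0"
    using infsum_reindex_bij_betw[OF bij_betw_of_int_vec, of "\<lambda>x :: real ^ 'n. exp (- t * (norm x)\<^sup>2)"] mass
    by (simp add: gaussian_mass_def gauss_def H_def)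
  have gauss_sum: "(\<lambda>m. gauss (of_int_vec m)) summable_on UNIV"
    using summable_on_gaussian[OF t, of 0] by (simp add: gauss_def)

  have main: "(\<forall>m. m \<noteq> (\<lambda>_. 0) \<longrightarrow> h (R (of_int_vec m)) = gauss (R (of_int_vec m)))
      \<and> (\<forall>s. (\<forall>i. \<bar>s $ i\<bar> \<le> 1/2) \<longrightarrow> (\<Sum>\<^sub>\<infinity>m. h (R (of_int_vec m + s))) = H)"
    if R: "orthogonal_transformation R" for R :: "real ^ 'n \<Rightarrow> real ^ 'n"
  proof -
    have lin: "linear R"
      using R by (rule orthogonal_transformation_linear)
    have R_norm: "norm (R x) = norm x" for x
      using R by (simp add: orthogonal_transformation_norm)
    have R_cont: "continuous_on UNIV R"
      using lin by (simp add: linear_continuous_on linear_conv_bounded_linear)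
    have R_0: "R (of_int_vec m) \<noteq> 0" if "m \<noteq> (\<lambda>_. 0)" for m
      using that R_norm[of "of_int_vec m"] by (metis norm_eq_zero of_int_vec_eq_0_iff)
    obtain L where L: "unimodular_lattice L" "integral_lattice L" "\<And>m. R (of_int_vec m) \<in> L"
      using orthogonal_image_lattice[OF R] by metis
    have g_cont: "continuous_on UNIV (\<lambda>x. h (R x))"
      by (rule continuous_on_compose2[OF cont R_cont]) simp
    have g_bound: "\<bar>h (R x)\<bar> \<le> C * decay x" for x
      by (rule C) (rule R_norm)
    have g_even: "h (R (- x)) = h (R x)" for x
      using even by (simp add: linear_neg[OF lin])
    have g_neg: "(LINT y|lborel. h (R y) * cos (2 * pi * (of_int_vec k \<bullet> y))) \<le> 0"
      if "k \<noteq> (\<lambda>_. 0)" for k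
    proof -
      have "(LINT y|lborel. h (R y) * cos (2 * pi * (of_int_vec k \<bullet> y)))
          = (LINT y|lborel. h (R y) * cos (2 * pi * (R (of_int_vec k) \<bullet> R y)))"
        using R by (simp add: orthogonal_transformation_def)
      also have "\<dots> = real_fourier h (R (of_int_vec k))"
        unfolding real_fourier_eq[OF h_int]
        by (rule lborel_integral_orthogonal[OF _ R, of "\<lambda>z. h z * cos (2 * pi * (R (of_int_vec k) \<bullet> z))"])
           measurable
      also have "\<dots> \<le> 0"
        using fourier_le L R_0[OF that] by blast
      finally show ?thesis .
    qed
    have g_int: "(LINT y|lborel. h (R y)) = H"
      unfolding H by (rule lborel_integral_orthogonal[OF h_meas R])
    \<comment> \<open>\<open>D\<close> is the slack in (i). At the origin, where (i) says nothing,
      the correction makes it 0. By (iii) its total is the sum of \<open>h \<circ> R\<close> over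
      the integer vectors minus \<open>H\<close>.\<close>
    define D where "D m = h (R (of_int_vec m)) - gauss (of_int_vec m) - (if m = (\<lambda>_. 0) then h 0 - 1 else 0)"
      for m
    have D_nonneg: "D m \<ge> 0" for m
    proof (cases "m = (\<lambda>_. 0)")
      case True
      then have "of_int_vec m = (0 :: real ^ 'n)"
        by (simp add: of_int_vec_eq_0_iff)
      with True show ?thesis
        by (simp add: D_def gauss_def linear_0[OF lin])
    next
      case False
      then have "h (R (of_int_vec m)) \<ge> exp (- t * (norm (R (of_int_vec m)))\<^sup>2)"
        using ge_gauss L R_0[OF False] by blast
      with False show ?thesis
        by (simp add: D_def gauss_def R_norm)
    qed
    have "((\<lambda>m. if m = (\<lambda>_. 0) then h 0 - 1 else 0) has_sum (h 0 - 1)) (UNIV :: ('n \<Rightarrow> int) set)"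
      by (rule has_sum_finite_neutralI[of "{\<lambda>_. 0}"]) auto
    moreover have "((\<lambda>m. h (R (of_int_vec m))) has_sum (\<Sum>\<^sub>\<infinity>m. h (R (of_int_vec m)))) UNIV"
      by (intro has_sum_infsum fejer_poisson(1)[OF g_cont g_bound])
    moreover have "((\<lambda>m. gauss (of_int_vec m)) has_sum (H + 1 - h 0)) UNIV"
      unfolding mass'[symmetric] by (rule has_sum_infsum[OF gauss_sum])
    ultimately have "((\<lambda>m. h (R (of_int_vec m)) + - gauss (of_int_vec m)
          + - (if m = (\<lambda>_. 0) then h 0 - 1 else 0))
        has_sum ((\<Sum>\<^sub>\<infinity>m. h (R (of_int_vec m))) + - (H + 1 - h 0) + - (h 0 - 1))) UNIV"
      by (intro has_sum_add has_sum_uminusI)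
    then have D_sum: "(D has_sum ((\<Sum>\<^sub>\<infinity>m. h (R (of_int_vec m))) - H)) UNIV"
      unfolding D_def[abs_def] by (simp add: algebra_simps)
    then have "(\<Sum>\<^sub>\<infinity>m. h (R (of_int_vec m))) - H \<ge> 0"
      using D_nonneg by (rule has_sum_nonneg)
    \<comment> \<open>This lower bound is the hypothesis \<open>ge\<close> of
      \<open>poisson_extremal\<close>, whose conclusion makes the total of the nonnegative
      \<open>D\<close> equal to 0, hence each term.\<close>
    then have "(LINT y|lborel. h (R y)) \<le> (\<Sum>\<^sub>\<infinity>m. h (R (of_int_vec m)))"
      by (simp add: g_int)
    note extremal = poisson_extremal[OF g_cont g_bound g_even g_neg this, unfolded g_int]
    have D_0: "D m = 0" for m
      using D_sum D_nonneg extremal(1) by (intro nonneg_has_sum_le_0D[of D UNIV 0]) simp_all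
    have "h (R (of_int_vec m)) = gauss (R (of_int_vec m))" if "m \<noteq> (\<lambda>_. 0)" for m
      using D_0[of m] that by (simp add: D_def gauss_def R_norm)
    then show ?thesis
      using extremal(2) by blast
  qed

  have theta_eq: "theta t (1/2) ^ card (B \<union> B') * theta t 0 ^ (CARD('n) - card (B \<union> B')) = H"
    if B: "card B = 4" and B': "B' = {} \<or> card B' = 4" and disj: "B \<inter> B' = {}" for B B' :: "'n set"
  proof -
    obtain i where i: "i \<in> B"
      using B by fastforce
    have "h (of_int_vec m + half_vec (B \<union> B')) = gauss (of_int_vec m + half_vec (B \<union> B'))" for m
    proof -
      obtain R :: "real ^ 'n \<Rightarrow> real ^ 'n" and k where R: "orthogonal_transformation R"
        and k: "of_int_vec m + half_vec (B \<union> B') = R (of_int_vec k)"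
        using half_vec_orthogonal_image[OF B B' disj] by metis
      have "k \<noteq> (\<lambda>_. 0)"
      proof
        assume "k = (\<lambda>_. 0)"
        then have "of_int_vec k = (0 :: real ^ 'n)"
          by (simp add: of_int_vec_eq_0_iff)
        then have "R (of_int_vec k) = 0"
          using linear_0[OF orthogonal_transformation_linear[OF R]] by simp
        then show False
          using half_vec_add_neq_0[of i "B \<union> B'" m] i k by simp
      qed
      then show ?thesis
        using main[OF R] unfolding k by blast
    qed
    \<comment> \<open>For the translated sum the identity serves as \<open>R\<close>. The rotations,
      which vary with \<open>m\<close>, only identify the individual summands.\<close>
    moreover have "(\<Sum>\<^sub>\<infinity>m. h (of_int_vec m + half_vec (B \<union> B'))) = H"
      using main[OF orthogonal_transformation_id] by (simp add: half_vec_def)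
    ultimately show ?thesis
      using infsum_gaussian_half_vec[OF t, of "B \<union> B'"] by (simp add: gauss_def)
  qed
  obtain B :: "'n set" where B: "card B = 4"
    using obtain_subset_with_card_n[of 4 "UNIV :: 'n set"] assms(1) by auto
  have "card (- B) \<ge> 4"
    using assms(1) B by (simp add: Compl_eq_Diff_UNIV card_Diff_subset)
  then obtain B' where B': "B' \<subseteq> - B" "card B' = 4"
    using obtain_subset_with_card_n by metis
  have disj: "B \<inter> B' = {}"
    using B' by auto
  then have card: "card (B \<union> B') = 8"
    using B B' by (simp add: card_Un_disjoint)
  let ?a = "theta t (1/2)" and ?b = "theta t 0"
  have pos: "theta t c > 0" for c
    using exp_le_theta[OF t, of c] by (rule less_le_trans[OF exp_gt_zero])
  \<comment> \<open>Both sides equal the unknown \<open>H\<close>, obtained from one block and from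
    two. Positivity of the theta sums then permits cancellation and fourth roots.\<close>
  have "?a ^ 4 * ?b ^ (CARD('n) - 4) = ?a ^ 8 * ?b ^ (CARD('n) - 8)"
    using theta_eq[OF B, of "{}"] theta_eq[OF B _ disj] B B' card by simp
  moreover have "?b ^ (CARD('n) - 4) = ?b ^ 4 * ?b ^ (CARD('n) - 8)"
    using assms(1) by (simp flip: power_add)
  moreover have "?a ^ 8 = ?a ^ 4 * ?a ^ 4"
    by (simp flip: power_add)
  ultimately have "(?a ^ 4 * ?b ^ (CARD('n) - 8)) * ?a ^ 4 = (?a ^ 4 * ?b ^ (CARD('n) - 8)) * ?b ^ 4"
    by (simp only: mult_ac)
  moreover have "?a ^ 4 * ?b ^ (CARD('n) - 8) \<noteq> 0"
    using pos[of "1/2"] pos[of 0] by simp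
  ultimately have "?a ^ 4 = ?b ^ 4"
    using mult_left_cancel by blast
  then have "?a = ?b"
    by (rule power_eq_imp_eq_base) (use pos less_imp_le in auto)
  then show False
    using theta_half_neq_theta_0[OF t] by simp
qed

end
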